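(* Let $n,r,s,t$ be integers with $s\ge 1$, $t\ge 0$ and $3\le s+2\le r\le \left\lfloor \frac{n+s-1}{2}\right\rfloor$. Let $S_n^t$ be the sun with $t$ rays and let $\mathcal{P}^r=\mathcal{P}^r(S_n^t)$ be the family of all paths on exactly $r$ vertices in $S_n^t$. Then $S_n^t$ is $(\mathcal{P}^r,s)$-EKR, and it is strictly so when $r<(n+s-1)/2$ and it is not the case that both $s=2$ and $t=1$. Moreover, define \[ f(r,s,t)=(r-s+1)+2t(r-s)+\begin{cases} \binom{t}{2}(r-s-1) & \text{when } r=3,\ s=1,\\ t^2(r-s) & \text{when } r\ge 4,\ t=1,\ s=2,\\ t^2(r-s-1) & \text{otherwise} \end{cases} \] (so that $f(3,1,t)=3+4t+\binom{t}{2}$ in the first case). If $\mathcal{F}\subseteq\mathcal{P}^r(S_n^t)$ is an $s$-intersecting family, then $|\mathcal{F}|\le f(r,s,t)$.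
   Context: The sun $S_n^t$ ($n\ge 3$, $t\ge 0$) is the graph with vertex set $\{v_i^j \mid 0\le i<n,\ 0\le j\le t\}$ and edges $v_i^0v_{i+1}^0$ for all $i$ (subscripts modulo $n$), together with $v_i^jv_i^0$ for all $i$ and all $0<j\le t$; i.e. it is an $n$-cycle with $t$ pendant vertices attached to each cycle vertex. A path is a subgraph; intersections of paths are taken as intersections of their vertex sets. A family $\mathcal{F}$ of paths is $s$-intersecting if $|V(A)\cap V(B)|\ge s$ for all $A,B\in\mathcal{F}$, and it is an $s$-star if $\left|\bigcap_{A\in\mathcal{F}}V(A)\right|\ge s$. For a family $\mathcal{F}$ of paths and a vertex set $X$ with $|X|=s$, the full $s$-star at $X$ is $\mathcal{F}_X=\{A\in\mathcal{F} \mid X\subseteq V(A)\}$. A graph $G$ is $(\mathcal{F},s)$-EKR, where $\mathcal{F}$ is a family of paths of $G$, if there is an $s$-set $X$ of vertices with $|\mathcal{F}_X|\ge|\mathcal{H}|$ for every $s$-intersecting $\mathcal{H}\subseteq\mathcal{F}$; it is strictly so if moreover every $s$-intersecting subfamily of $\mathcal{F}$ of maximum size is an $s$-star. *)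

theory Defs
  imports Complex_Main
begin

datatype 'a graph = Graph (verts: "'a set") (edges: "'a set set")

definition subgraph :: "'a graph \<Rightarrow> 'a graph \<Rightarrow> bool" where
  "subgraph H G \<longleftrightarrow> verts H \<subseteq> verts G \<and> edges H \<subseteq> edges G"

definition path_graph :: "'a list \<Rightarrow> 'a graph" where
  "path_graph xs = Graph (set xs) {{xs ! i, xs ! Suc i} | i. Suc i < length xs}"

(* A path is a subgraph, not a vertex sequence: a list and its reversal give the same path. *)
definition is_path :: "'a graph \<Rightarrow> bool" where
  "is_path P \<longleftrightarrow> (\<exists>xs. xs \<noteq> [] \<and> distinct xs \<and> P = path_graph xs)"

definition paths :: "nat \<Rightarrow> 'a graph \<Rightarrow> 'a graph set" where
  "paths r G = {P. subgraph P G \<and> is_path P \<and> card (verts P) = r}"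

(* The vertex v_i^j is the pair (i, j); the cycle vertices are the pairs (i, 0). *)
definition sun :: "nat \<Rightarrow> nat \<Rightarrow> (nat \<times> nat) graph" where
  "sun n t = Graph ({..<n} \<times> {..t})
     ({{(i, 0), ((i + 1) mod n, 0)} | i. i < n} \<union>
      {{(i, j), (i, 0)} | i j. i < n \<and> 0 < j \<and> j \<le> t})"

definition s_intersecting :: "nat \<Rightarrow> 'a graph set \<Rightarrow> bool" where
  "s_intersecting s F \<longleftrightarrow> (\<forall>A\<in>F. \<forall>B\<in>F. s \<le> card (verts A \<inter> verts B))"

(* For a nonempty family of subgraphs of G, intersecting with verts G changes nothing;
   it only fixes the empty intersection to be verts G instead of UNIV. *)
definition s_star :: "'a graph \<Rightarrow> nat \<Rightarrow> 'a graph set \<Rightarrow> bool" where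
  "s_star G s F \<longleftrightarrow> s \<le> card (verts G \<inter> (\<Inter>A\<in>F. verts A))"

definition full_star :: "'a graph set \<Rightarrow> 'a set \<Rightarrow> 'a graph set" where
  "full_star F X = {A \<in> F. X \<subseteq> verts A}"

(* G is (F,s)-EKR. Families are compared by card, so F is meant to be finite; this holds
   for every family of subgraphs of a finite graph, see finite_paths below. *)
definition EKR :: "'a graph \<Rightarrow> 'a graph set \<Rightarrow> nat \<Rightarrow> bool" where
  "EKR G F s \<longleftrightarrow> (\<exists>X \<subseteq> verts G. card X = s \<and>
     (\<forall>H \<subseteq> F. s_intersecting s H \<longrightarrow> card H \<le> card (full_star F X)))"

definition strictly_EKR :: "'a graph \<Rightarrow> 'a graph set \<Rightarrow> nat \<Rightarrow> bool" where
  "strictly_EKR G F s \<longleftrightarrow> EKR G F s \<and>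
     (\<forall>H \<subseteq> F. s_intersecting s H \<and>
        (\<forall>K \<subseteq> F. s_intersecting s K \<longrightarrow> card K \<le> card H) \<longrightarrow> s_star G s H)"

definition sun_bound :: "nat \<Rightarrow> nat \<Rightarrow> nat \<Rightarrow> int" where
  "sun_bound r s t = (int r - int s + 1) + 2 * int t * (int r - int s) +
     (if r = 3 \<and> s = 1 then int (t choose 2) * (int r - int s - 1)
      else if r \<ge> 4 \<and> t = 1 \<and> s = 2 then (int t)\<^sup>2 * (int r - int s)
      else (int t)\<^sup>2 * (int r - int s - 1))"

lemma finite_paths:
  assumes "finite (verts G)" "finite (edges G)"
  shows "finite (paths r G)"
proof (rule finite_subset)
  show "paths r G \<subseteq> (\<lambda>(V, E). Graph V E) ` (Pow (verts G) \<times> Pow (edges G))"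
  proof
    fix P assume "P \<in> paths r G"
    then have "(verts P, edges P) \<in> Pow (verts G) \<times> Pow (edges G)"
      by (auto simp: paths_def subgraph_def)
    then show "P \<in> (\<lambda>(V, E). Graph V E) ` (Pow (verts G) \<times> Pow (edges G))"
      by (metis (no_types, lifting) case_prod_conv graph.collapse image_eqI)
  qed
qed (use assms in simp)

lemma finite_paths_sun: "finite (paths r (sun n t))"
proof (rule finite_paths)
  have "edges (sun n t) \<subseteq> Pow ({..<n} \<times> {..t})"
    by (auto simp: sun_def)
  then show "finite (edges (sun n t))"
    by (rule finite_subset) simp
qed (simp add: sun_def)

end

(* A path meets the cycle in an arc, and is determined by that arc and the labels of its pendant
   vertices. For fixed labels, the starting points of the arcs (of length l) in an s-intersecting
   family are pairwise at cyclic distance at most l - s, so Katona's pairing argument leaves at most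
   l - s + 1 of them; summing over the labels gives the size of the full star at s consecutive cycle
   vertices. Pendant vertices can replace a missing common cycle vertex only for s = 2, which is
   treated separately. Equality makes the paths without pendant vertices an extremal family, whose
   starting points are consecutive, and a path that s-intersects all of them contains their common
   segment. *)
theory Submission
  imports Defs
begin

subsection \<open>Arcs on a cycle\<close>

text \<open>Two arcs can overlap at both ends, around the whole cycle. The hypothesis
  \<open>2 * r + 1 \<le> n + s\<close> makes this harmless: two nonempty pieces together have at
  most \<open>2 * r - n < s\<close> vertices, so one piece alone must supply all \<open>s\<close>,
  and that bounds the distance of the starting points. For paths with pendant vertices at the same
  ends and different starting points, a common pendant vertex is the right end of one and the left
  end of the other; the cores touch there in a single vertex. The overlap thus grows from one to
  two, which matters only for \<open>s = 2\<close>. If \<open>2 \<le> t\<close>, the labels forced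
  at such a contact cost more than the additional starting point gains. If \<open>t = 1\<close>
  there are no labels to lose: one more path with two pendant vertices becomes possible, but only at
  the price of one without any. The totals then tie, so size alone does not determine the
  pendant-free paths. Extremal sets of starting points need room to be consecutive: for
  \<open>n = 2 * m + 2\<close> the only points that are not near are antipodal, and one of each
  antipodal pair can be chosen freely.\<close>

definition cdiff :: "nat \<Rightarrow> nat \<Rightarrow> nat \<Rightarrow> nat" where
  "cdiff n x y = (if x \<le> y then y - x else y + n - x)"

text \<open>The second disjunct is the distance in the opposite direction,
  \<open>n - cdiff n x y \<le> m\<close>, written additively.\<close>

definition near :: "nat \<Rightarrow> nat \<Rightarrow> nat \<Rightarrow> nat \<Rightarrow> bool" where
  "near n m x y \<longleftrightarrow> cdiff n x y \<le> m \<or> n \<le> cdiff n x y + m"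

definition arc :: "nat \<Rightarrow> nat \<Rightarrow> nat \<Rightarrow> nat set" where
  "arc n i l = {z. z < n \<and> cdiff n i z < l}"

lemma mod_add_if: "c < n \<Longrightarrow> x < n \<Longrightarrow> (c + x) mod n = (if c + x < n then c + x else c + x - n)"
  for c x n :: nat
  by (auto simp: mod_if)

lemma cdiff_less: "x < n \<Longrightarrow> y < n \<Longrightarrow> cdiff n x y < n"
  by (auto simp: cdiff_def)

lemma add_cdiff: "x < n \<Longrightarrow> y < n \<Longrightarrow> (x + cdiff n x y) mod n = y"
  by (auto simp: cdiff_def)

lemma cdiff_add: "c < n \<Longrightarrow> x < n \<Longrightarrow> cdiff n c ((c + x) mod n) = x"
  by (auto simp: cdiff_def mod_add_if)

lemma cdiff_inj: "p < n \<Longrightarrow> x < n \<Longrightarrow> y < n \<Longrightarrow> cdiff n p x = cdiff n p y \<Longrightarrow> x = y"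
  by (metis add_cdiff)

lemma cdiff_cdiff:
  assumes "p < n" "x < n" "y < n"
  shows "cdiff n x y = cdiff n (cdiff n p x) (cdiff n p y)"
  using assms by (auto simp: cdiff_def)

lemma cdiff_eq_0_iff: "x < n \<Longrightarrow> y < n \<Longrightarrow> cdiff n x y = 0 \<longleftrightarrow> x = y"
  by (auto simp: cdiff_def)

lemma cdiff_swap: "x < n \<Longrightarrow> y < n \<Longrightarrow> x \<noteq> y \<Longrightarrow> cdiff n y x = n - cdiff n x y"
  by (auto simp: cdiff_def)

text \<open>Katona's pairing, with distances measured from some \<open>p \<in> S\<close>: a distance
  \<open>d \<le> m\<close> is paired with \<open>d + n - (m + 1)\<close>. The two points are
  \<open>m + 1\<close> apart one way and at least that far the other way, so \<open>S\<close>
  contains at most one of them. The map \<open>g\<close> names the pair, and there are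
  \<open>m + 1\<close> pairs.\<close>

lemma near_card_le:
  assumes S: "S \<subseteq> {..<n}" and near: "\<And>x y. x \<in> S \<Longrightarrow> y \<in> S \<Longrightarrow> near n m x y"
    and n: "2 * m + 2 \<le> n"
  shows "card S \<le> m + 1"
proof (cases "S = {}")
  case False
  then obtain p where p: "p \<in> S" by blast
  define g where "g x = (let d = cdiff n p x in if d \<le> m then d else d + m + 1 - n)" for x
  have "inj_on g S"
  proof (rule inj_onI)
    fix x y assume xy: "x \<in> S" "y \<in> S" "g x = g y"
    have b: "p < n" "x < n" "y < n" using S p xy by auto
    have "near n m p x" "near n m p y" "near n m x y" "near n m y x" using near p xy by auto
    then have "cdiff n p x = cdiff n p y"
      using xy(3) n cdiff_less[of p n x] cdiff_less[of p n y] b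
      by (auto simp: near_def g_def Let_def cdiff_cdiff[OF b] cdiff_cdiff[OF b(1,3,2)]
          cdiff_def[of n "cdiff n p x"] cdiff_def[of n "cdiff n p y"] split: if_splits)
    then show "x = y" using cdiff_inj b by blast
  qed
  moreover have "g ` S \<subseteq> {..m}"
  proof
    fix z assume "z \<in> g ` S"
    then obtain x where x: "x \<in> S" "z = g x" by blast
    then have "cdiff n p x < n" using S p cdiff_less by blast
    then show "z \<in> {..m}" using x by (auto simp: g_def Let_def)
  qed
  ultimately have "card S \<le> card {..m}" by (metis card_inj_on_le finite_atMost)
  then show ?thesis by simp
qed simp

text \<open>Start from a \<open>p \<in> S\<close> whose predecessor is not in \<open>S\<close>. Exactly one of \<open>p + d\<close> and
  \<open>p + d - (m + 1)\<close> lies in \<open>S\<close> for \<open>d = m, m - 1, \<dots>, 1\<close>; taking \<open>d\<close> downwards, it is always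
  \<open>p + d\<close>.\<close>

lemma near_card_eq:
  assumes S: "S \<subseteq> {..<n}" and near: "\<And>x y. x \<in> S \<Longrightarrow> y \<in> S \<Longrightarrow> near n m x y"
    and n: "2 * m + 3 \<le> n" and card: "card S = m + 1"
  obtains c where "c < n" "S = (\<lambda>x. (c + x) mod n) ` {..m}"
proof -
  have fin: "finite S" using S finite_subset by blast
  have "\<exists>p\<in>S. (p + (n - 1)) mod n \<notin> S"
  proof (rule ccontr)
    assume "\<not> ?thesis"
    then have step: "(p + (n - 1)) mod n \<in> S" if "p \<in> S" for p using that by blast
    obtain q where q: "q \<in> S" using card by fastforce
    have all: "(q + k * (n - 1)) mod n \<in> S" for k
    proof (induction k)
      case 0 then show ?case using q S by auto
    next
      case (Suc k)
      then have "((q + k * (n - 1)) mod n + (n - 1)) mod n \<in> S" using step by blast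
      moreover have "q + Suc k * (n - 1) = (q + k * (n - 1)) + (n - 1)" by simp
      ultimately show ?case by (simp only: mod_add_left_eq)
    qed
    \<comment> \<open>A step of \<open>n - 1\<close> is one step back, so \<open>z\<close> is
      reached from \<open>q\<close> after \<open>cdiff n z q\<close> of them. A nonempty set closed
      under predecessors is therefore the whole cycle, which has more than \<open>m + 1\<close>
      points.\<close>
    have "{..<n} \<subseteq> S"
    proof
      fix z assume "z \<in> {..<n}"
      then have z: "z < n" by simp
      have qn: "q < n" using q S by auto
      define k where "k = cdiff n z q"
      have zk: "(z + k) mod n = q" using add_cdiff z qn k_def by simp
      have "(q + k * (n - 1)) mod n = ((z + k) + k * (n - 1)) mod n"
        by (simp add: zk[symmetric] mod_add_left_eq)
      also have "(z + k) + k * (n - 1) = z + k * n"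
        using n by (cases n) auto
      also have "(z + k * n) mod n = z" using z by simp
      finally show "z \<in> S" using all[of k] by simp
    qed
    then have "card {..<n} \<le> card S" by (rule card_mono[OF fin])
    then show False using card n by simp
  qed
  then obtain p where p: "p \<in> S" "(p + (n - 1)) mod n \<notin> S" by blast
  have pn: "p < n" using p S by auto
  define T where "T = cdiff n p ` S"
  have injp: "inj_on (cdiff n p) S" using cdiff_inj pn S by (meson inj_onI lessThan_iff subsetD)
  have cT: "card T = m + 1" unfolding T_def using card_image injp card by metis
  have T0: "0 \<in> T" unfolding T_def using p cdiff_eq_0_iff[of p n p] pn by (metis imageI)
  have Tn: "T \<subseteq> {..<n}" unfolding T_def using cdiff_less pn S by auto
  have last: "n - 1 \<notin> T"
  proof
    assume "n - 1 \<in> T"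
    then obtain x where "x \<in> S" "cdiff n p x = n - 1" unfolding T_def by auto
    then show False using p add_cdiff[OF pn, of x] S by auto
  qed
  have Tnear: "near n m x y" if xy: "x \<in> T" "y \<in> T" for x y
  proof -
    obtain u v where uv: "u \<in> S" "v \<in> S" "x = cdiff n p u" "y = cdiff n p v"
      using xy unfolding T_def by blast
    moreover have "u < n" "v < n" using uv S by auto
    ultimately show ?thesis using near[OF uv(1,2)] cdiff_cdiff[OF pn, of u v] by (simp add: near_def)
  qed
  have Tdist: "\<not> (x \<in> T \<and> y \<in> T)" if "x + m < y" "y + m < n + x" for x y
  proof
    assume "x \<in> T \<and> y \<in> T"
    then have "near n m x y" using Tnear by blast
    then have "y - x \<le> m \<or> n \<le> (y - x) + m" using that unfolding near_def cdiff_def by auto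
    then show False using that by linarith
  qed
  define g where "g d = (if d \<le> m then d else d + m + 1 - n)" for d
  have ginj: "inj_on g T"
  proof (rule inj_onI)
    fix x y assume xy: "x \<in> T" "y \<in> T" "g x = g y"
    have "x \<le> m \<or> n \<le> x + m" "y \<le> m \<or> n \<le> y + m"
      using Tnear[OF T0] xy(1,2) by (auto simp: near_def cdiff_def)
    moreover have "y \<le> x + m \<or> n + x \<le> y + m" "x \<le> y + m \<or> n + y \<le> x + m"
      using Tdist xy(1,2) not_le by blast+
    moreover have "x < n" "y < n" using Tn xy(1,2) by auto
    ultimately show "x = y" using xy(3) n unfolding g_def by (auto split: if_splits)
  qed
  have gsub: "g ` T \<subseteq> {..m}"
  proof
    fix z assume "z \<in> g ` T"
    then obtain x where "x < n" "z = g x" using Tn by blast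
    then show "z \<in> {..m}" by (auto simp: g_def)
  qed
  \<comment> \<open>An injection into a set of the same size \<open>m + 1\<close> is onto: no pair
    is missed.\<close>
  have geq: "g ` T = {..m}"
    by (rule card_subset_eq) (simp_all add: gsub card_image[OF ginj] cT)
  have pair: "d \<in> T \<or> d + n - (m + 1) \<in> T" if "d \<le> m" for d
  proof -
    have "d \<in> g ` T" using geq that by simp
    then obtain x where "x \<in> T" "g x = d" by blast
    moreover from this have "x \<le> m \<or> n \<le> x + m" using Tnear[OF T0] by (auto simp: near_def cdiff_def)
    ultimately have "x = d \<or> x = d + n - (m + 1)" using n by (auto simp: g_def split: if_splits)
    with \<open>x \<in> T\<close> show ?thesis by auto
  qed
  have "m - k \<in> T" for k
  proof (induction k)
    case 0 then show ?case using pair[of m] last by auto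
  next
    case (Suc k)
    show ?case
    proof (cases "k < m")
      case True
      \<comment> \<open>The partner of \<open>m - Suc k\<close> is at distance
        \<open>n - m - 2\<close> from \<open>m - k\<close> in one direction and \<open>m + 2\<close>
        in the other. Both exceed \<open>m\<close>, the former because of
        \<open>2 * m + 3 \<le> n\<close>.\<close>
      then have "m - Suc k + n - (m + 1) \<notin> T"
        using Suc Tdist[of "m - k" "m - Suc k + n - (m + 1)"] n by linarith
      then show ?thesis using pair[of "m - Suc k"] by simp
    qed (use Suc in auto)
  qed
  then have "{..m} \<subseteq> T" by (metis atMost_iff diff_diff_cancel subsetI)
  then have Teq: "T = {..m}"
    using cT Tn card_subset_eq[of T "{..m}"] finite_subset[OF Tn] by simp
  have "S = (\<lambda>x. (p + x) mod n) ` T"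
  proof -
    have "(\<lambda>x. (p + cdiff n p x) mod n) ` S = (\<lambda>x. x) ` S"
      by (rule image_cong) (use add_cdiff[OF pn] S in auto)
    then show ?thesis unfolding T_def image_image by simp
  qed
  then show ?thesis using that pn Teq by blast
qed

section \<open>Sizes and intersections of arcs\<close>

lemma card_arc_le: "i < n \<Longrightarrow> card (arc n i l) \<le> l"
proof -
  assume i: "i < n"
  have "inj_on (cdiff n i) (arc n i l)" using cdiff_inj[OF i] by (auto simp: arc_def inj_on_def)
  moreover have "cdiff n i ` arc n i l \<subseteq> {..<l}" by (auto simp: arc_def)
  ultimately have "card (arc n i l) \<le> card {..<l}" by (intro card_inj_on_le) auto
  then show ?thesis by simp
qed

lemma finite_arc: "finite (arc n i l)" by (simp add: arc_def)

lemma arc_eq_image: "i < n \<Longrightarrow> l \<le> n \<Longrightarrow> arc n i l = (\<lambda>x. (i + x) mod n) ` {..<l}"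
proof (intro set_eqI iffI)
  fix z assume i: "i < n" "l \<le> n"
  {
    assume "z \<in> arc n i l"
    then show "z \<in> (\<lambda>x. (i + x) mod n) ` {..<l}"
      using add_cdiff[OF i(1), of z] by (intro image_eqI[of _ _ "cdiff n i z"]) (auto simp: arc_def)
  next
    assume "z \<in> (\<lambda>x. (i + x) mod n) ` {..<l}"
    then show "z \<in> arc n i l"
      using cdiff_add[OF i(1)] i by (auto simp: arc_def)
  }
qed

text \<open>One piece runs from \<open>k\<close> to the end of the first arc, the other from
  \<open>i\<close> to the end of the second arc after it has gone round. Truncated subtraction makes
  an absent piece count zero.\<close>

lemma card_arc_Int_le:
  assumes "i < n" "k < n"
  shows "card (arc n i l \<inter> arc n k l') \<le> (l - cdiff n i k) + (l' - (n - cdiff n i k))"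
proof -
  have "arc n i l \<inter> arc n k l' \<subseteq> arc n k (l - cdiff n i k) \<union> arc n i (l' - (n - cdiff n i k))"
    using assms by (auto simp: arc_def cdiff_def split: if_splits)
  then have "card (arc n i l \<inter> arc n k l') \<le> card (arc n k (l - cdiff n i k) \<union> arc n i (l' - (n - cdiff n i k)))"
    by (intro card_mono) (auto simp: finite_arc)
  also have "\<dots> \<le> card (arc n k (l - cdiff n i k)) + card (arc n i (l' - (n - cdiff n i k)))"
    by (rule card_Un_le)
  finally show ?thesis using card_arc_le assms by (meson add_mono le_trans)
qed

text \<open>The danger is an arc that meets the first and the last of the arcs around the far side of the
  cycle; the \<open>x\<close> chosen in the proof is an intermediate arc that it then meets in too few points.\<close>

lemma common_segment_subset_arc:
  assumes n: "2 * r + 1 \<le> n + s" and s: "1 \<le> s" "s \<le> r" and l: "l \<le> r" and c: "c < n" "k < n"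
    and int: "\<And>x. x \<le> r - s \<Longrightarrow> s \<le> card (arc n ((c + x) mod n) r \<inter> arc n k l)"
  shows "(\<lambda>x. (c + x) mod n) ` {r - s..<r} \<subseteq> arc n k l"
proof -
  define D where "D = cdiff n c k"
  have D: "D < n" "k = (c + D) mod n" using c cdiff_less add_cdiff unfolding D_def by auto
  \<comment> \<open>Measured from \<open>c\<close>, the given arc starts at \<open>D\<close> and the
    others start at \<open>x\<close>. The two overlap pieces cannot reach \<open>s\<close> jointly,
    so one of them does so alone.\<close>
  have *: "(if x \<le> D then D - x + s \<le> r \<or> n + s \<le> l + D - x else D + n + s \<le> r + x \<or> s + x \<le> l + D)"
    if x: "x \<le> r - s" for x
  proof -
    define d where "d = cdiff n ((c + x) mod n) k"
    have xn: "x < n" using x n s by linarith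
    have deq: "d = cdiff n x D"
      using cdiff_cdiff[OF c(1), of "(c + x) mod n" k] xn c cdiff_add[OF c(1) xn] unfolding d_def D_def by simp
    have "s \<le> (r - d) + (l - (n - d))"
      using le_trans[OF int[OF x] card_arc_Int_le[of "(c + x) mod n" n k r l]] c unfolding d_def by simp
    then show ?thesis using n l s D xn unfolding deq cdiff_def by (auto split: if_splits)
  qed
  have Dr: "D + s \<le> r"
  proof (rule ccontr)
    assume "\<not> ?thesis"
    with *[of 0] have "n + s \<le> l + D" by auto
    \<comment> \<open>For this \<open>x\<close> the piece past the origin,
      \<open>l + D - n - x\<close>, has \<open>s - 1\<close> vertices, while the other piece is
      empty by the bound on \<open>r\<close>.\<close>
    moreover define x where "x = l + D + 1 - n - s"
    ultimately have "x \<le> r - s" "x + n + s = l + D + 1" using D n l s by linarith+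
    then show False using *[of x] D n l s by (auto split: if_splits)
  qed
  have "s \<le> card (arc n k l)"
    using int[of 0] card_mono[OF finite_arc, of "arc n ((c + 0) mod n) r \<inter> arc n k l" n k l] by simp
  then have "s \<le> l" using card_arc_le c by (meson le_trans)
  then have Dl: "r \<le> D + l" using *[of "r - s"] *[of 0] Dr n s l D by (auto split: if_splits)
  show ?thesis
  proof
    fix z assume "z \<in> (\<lambda>x. (c + x) mod n) ` {r - s..<r}"
    then obtain x where x: "r - s \<le> x" "x < r" "z = (c + x) mod n" by auto
    have xn: "x < n" using x n s by linarith
    have "cdiff n k z = cdiff n D x"
      using cdiff_cdiff[OF c(1,2), of z] cdiff_add[OF c(1) xn] x c unfolding D_def by auto
    then show "z \<in> arc n k l" using x xn Dr Dl c by (auto simp: arc_def cdiff_def)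
  qed
qed

subsection \<open>Paths in the sun\<close>

lemma path_graph_rev: "path_graph (rev xs) = path_graph xs"
proof -
  have sub: "edges (path_graph (rev xs)) \<subseteq> edges (path_graph xs)" for xs :: "'a list"
  proof
    fix e assume "e \<in> edges (path_graph (rev xs))"
    then obtain i where i: "Suc i < length xs" "e = {rev xs ! i, rev xs ! Suc i}"
      by (auto simp: path_graph_def)
    define j where "j = length xs - Suc (Suc i)"
    have "rev xs ! i = xs ! Suc j" "rev xs ! Suc i = xs ! j" "Suc j < length xs"
      using i by (auto simp: j_def rev_nth Suc_diff_Suc)
    then show "e \<in> edges (path_graph xs)" using i by (auto simp: path_graph_def insert_commute)
  qed
  have "edges (path_graph (rev xs)) = edges (path_graph xs)"
    using sub[of xs] sub[of "rev xs"] by simp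
  then show ?thesis by (simp add: path_graph_def)
qed

lemma edges_path_graph_subset_iff:
  "edges (path_graph xs) \<subseteq> E \<longleftrightarrow> successively (\<lambda>x y. {x, y} \<in> E) xs"
proof -
  have all: "(\<forall>i. Q i) \<longleftrightarrow> Q 0 \<and> (\<forall>i. Q (Suc i))" for Q :: "nat \<Rightarrow> bool"
    by (metis not0_implies_Suc)
  have "successively P xs \<longleftrightarrow> (\<forall>i. Suc i < length xs \<longrightarrow> P (xs ! i) (xs ! Suc i))" for P
  proof (induction P xs rule: successively.induct)
    case (3 P x y xs)
    then show ?case by (subst all) simp
  qed simp_all
  then show ?thesis by (auto simp: path_graph_def)
qed

lemma sun_edge_iff:
  "{(i, j), (k, l)} \<in> edges (sun n t) \<longleftrightarrow>
    i < n \<and> k < n \<and> (j = 0 \<and> l = 0 \<and> (k = (i + 1) mod n \<or> i = (k + 1) mod n)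
      \<or> l = 0 \<and> 0 < j \<and> j \<le> t \<and> k = i \<or> j = 0 \<and> 0 < l \<and> l \<le> t \<and> k = i)"
proof -
  have "{(i, j), (k, l)} \<in> edges (sun n t) \<longleftrightarrow>
      (\<exists>m<n. {(i, j), (k, l)} = {(m, 0), ((m + 1) mod n, 0)}) \<or>
      (\<exists>m q. m < n \<and> 0 < q \<and> q \<le> t \<and> {(i, j), (k, l)} = {(m, q), (m, 0)})"
    unfolding sun_def by (simp, blast)
  moreover have "(\<exists>m<n. {(i, j), (k, l)} = {(m, 0), ((m + 1) mod n, 0)}) \<longleftrightarrow>
      i < n \<and> k < n \<and> j = 0 \<and> l = 0 \<and> (k = (i + 1) mod n \<or> i = (k + 1) mod n)"
    unfolding doubleton_eq_iff by (cases "n = 0") auto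
  moreover have "(\<exists>m q. m < n \<and> 0 < q \<and> q \<le> t \<and> {(i, j), (k, l)} = {(m, q), (m, 0)}) \<longleftrightarrow>
      i < n \<and> k = i \<and> (l = 0 \<and> 0 < j \<and> j \<le> t \<or> j = 0 \<and> 0 < l \<and> l \<le> t)"
    unfolding doubleton_eq_iff by auto
  moreover have "k = i \<Longrightarrow> i < n \<longleftrightarrow> k < n" by simp
  ultimately show ?thesis by (simp only:) meson
qed

text \<open>A path is encoded by the first vertex \<open>i\<close> of its intersection with the cycle (an arc) and
  the labels \<open>a\<close>, \<open>b\<close> of its pendant vertices at the two ends of that arc, where \<open>0\<close> stands
  for no pendant vertex.\<close>

definition core_len :: "nat \<Rightarrow> nat \<Rightarrow> nat \<Rightarrow> nat" where
  "core_len r a b = r - (if 0 < a then 1 else 0) - (if 0 < b then 1 else 0)"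

definition core_walk :: "nat \<Rightarrow> nat \<Rightarrow> nat \<Rightarrow> (nat \<times> nat) list" where
  "core_walk n i l = map (\<lambda>x. ((i + x) mod n, 0)) [0..<l]"

definition sun_walk :: "nat \<Rightarrow> nat \<Rightarrow> nat \<Rightarrow> nat \<Rightarrow> nat \<Rightarrow> (nat \<times> nat) list" where
  "sun_walk r n i a b = (if 0 < a then [(i, a)] else []) @ core_walk n i (core_len r a b) @
     (if 0 < b then [((i + core_len r a b - 1) mod n, b)] else [])"

text \<open>For \<open>r = 3\<close> with two pendant vertices the core is a single vertex from
  which both hang: the labels differ, and their order is only the direction of traversal. Fixing the
  order turns \<open>t\<^sup>2\<close> into \<open>t choose 2\<close>.\<close>

definition sun_codes :: "nat \<Rightarrow> nat \<Rightarrow> nat \<Rightarrow> (nat \<times> nat \<times> nat) set" where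
  "sun_codes r n t = {(i, a, b). i < n \<and> a \<le> t \<and> b \<le> t \<and> (r = 3 \<and> 0 < a \<and> 0 < b \<longrightarrow> a < b)}"

lemma core_len_bounds: "core_len r a b \<le> r" "3 \<le> r \<Longrightarrow> 1 \<le> core_len r a b"
  by (auto simp: core_len_def)

lemma set_sun_walk:
  assumes "i < n" "r \<le> n"
  shows "set (sun_walk r n i a b) = arc n i (core_len r a b) \<times> {0} \<union> (if 0 < a then {(i, a)} else {})
    \<union> (if 0 < b then {((i + core_len r a b - 1) mod n, b)} else {})"
proof -
  have "set (core_walk n i l) = arc n i l \<times> {0}" if "l \<le> n" for l
    using arc_eq_image[OF assms(1) that] by (auto simp: core_walk_def)
  then show ?thesis using core_len_bounds(1)[of r a b] assms by (auto simp: sun_walk_def)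
qed

lemma sun_walk_path:
  assumes c: "(i, a, b) \<in> sun_codes r n t" and r: "3 \<le> r" "r \<le> n"
  shows "path_graph (sun_walk r n i a b) \<in> paths r (sun n t)"
proof -
  let ?l = "core_len r a b" and ?xs = "sun_walk r n i a b"
  have i: "i < n" "a \<le> t" "b \<le> t" using c by (auto simp: sun_codes_def)
  have l: "1 \<le> ?l" "?l \<le> n" using core_len_bounds r by (auto intro: le_trans)
  have "inj_on (\<lambda>x. (i + x) mod n) {..<n}" 
  proof (rule inj_onI)
    fix x y assume xy: "x \<in> {..<n}" "y \<in> {..<n}" "(i + x) mod n = (i + y) mod n"
    have "x = cdiff n i ((i + x) mod n)" using cdiff_add[OF i(1)] xy(1) by simp
    also have "\<dots> = y" unfolding xy(3) using cdiff_add[OF i(1)] xy(2) by simp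
    finally show "x = y" .
  qed
  then have "inj_on (\<lambda>x. (i + x) mod n) {..<?l}" by (rule inj_on_subset) (use l in auto)
  then have dist: "distinct (core_walk n i ?l)"
    by (auto simp: core_walk_def distinct_map intro!: inj_onI dest: inj_onD)
  \<comment> \<open>The ends of the core coincide only for a one-vertex core; there
    \<open>a < b\<close> keeps the pendant vertices distinct.\<close>
  have one: "i = (i + ?l - 1) mod n \<Longrightarrow> ?l = 1"
    using l i cdiff_add[OF i(1), of "?l - 1"] by (simp add: cdiff_def)
  have "0 < a \<Longrightarrow> 0 < b \<Longrightarrow> ?l = 1 \<Longrightarrow> a < b"
    using c r by (auto simp: sun_codes_def core_len_def)
  then have distinct: "distinct ?xs"
    using dist one by (auto simp: sun_walk_def core_walk_def)
  have succ: "successively (\<lambda>x y. {x, y} \<in> edges (sun n t)) (core_walk n i l)" for l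
  proof (induction l)
    case (Suc l)
    then show ?case using i
      by (cases l) (auto simp: core_walk_def successively_append_iff sun_edge_iff mod_Suc_eq)
  qed (simp add: core_walk_def)
  have ne: "core_walk n i ?l \<noteq> []" "hd (core_walk n i ?l) = (i, 0)"
    "last (core_walk n i ?l) = ((i + ?l - 1) mod n, 0)"
    using l i by (auto simp: core_walk_def hd_map last_map)
  have "successively (\<lambda>x y. {x, y} \<in> edges (sun n t)) ?xs"
    using succ[of ?l] ne i by (auto simp: sun_walk_def successively_append_iff sun_edge_iff)
  then have "edges (path_graph ?xs) \<subseteq> edges (sun n t)"
    by (simp add: edges_path_graph_subset_iff)
  moreover have "verts (path_graph ?xs) \<subseteq> verts (sun n t)"
    using i set_sun_walk[OF i(1) r(2)] by (auto simp: path_graph_def sun_def arc_def)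
  moreover have "length ?xs = r" using r by (auto simp: sun_walk_def core_walk_def core_len_def)
  moreover have "?xs \<noteq> []" using ne by (auto simp: sun_walk_def)
  moreover from this have "is_path (path_graph ?xs)" using distinct unfolding is_path_def by blast
  ultimately show ?thesis
    using distinct_card[OF distinct] by (simp add: paths_def subgraph_def path_graph_def)
qed

definition up_walk :: "nat \<Rightarrow> (nat \<times> nat) list \<Rightarrow> bool" where
  "up_walk n = successively (\<lambda>x y. fst y = (fst x + 1) mod n)"

lemma up_walk_eq_core_walk:
  assumes "up_walk n ys" "ys \<noteq> []" "\<And>y. y \<in> set ys \<Longrightarrow> snd y = 0 \<and> fst y < n"
  shows "ys = core_walk n (fst (hd ys)) (length ys)"
  using assms(2,1,3)
proof (induction ys rule: rev_nonempty_induct)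
  case (single x)
  then show ?case by (cases x) (auto simp: core_walk_def)
next
  case (snoc x xs)
  have IH: "xs = core_walk n (fst (hd xs)) (length xs)"
    using snoc by (auto simp: up_walk_def successively_append_iff)
  have "last xs = ((fst (hd xs) + (length xs - 1)) mod n, 0)"
    by (subst IH) (use snoc.hyps in \<open>simp add: core_walk_def last_map\<close>)
  moreover have "fst x = (fst (last xs) + 1) mod n"
    using snoc by (auto simp: up_walk_def successively_append_iff)
  ultimately have "fst x = (fst (hd xs) + (length xs - 1) + 1) mod n" by (simp add: mod_Suc_eq)
  then have "x = ((fst (hd xs) + length xs) mod n, 0)"
    using snoc.prems(2)[of x] snoc.hyps by (cases xs) (simp_all add: prod_eq_iff)
  then show ?case using IH snoc.hyps by (simp add: core_walk_def)
qed

text \<open>Turning round would revisit the vertex before last, so the direction of the first step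
  is kept.\<close>

lemma cycle_walk_up_or_down:
  assumes "successively (\<lambda>x y. {x, y} \<in> edges (sun n t)) ys" "distinct ys" "\<And>y. y \<in> set ys \<Longrightarrow> snd y = 0"
  shows "up_walk n ys \<or> up_walk n (rev ys)"
  using assms
proof (induction ys rule: induct_list012)
  case (3 x y zs)
  then have IH: "up_walk n (y # zs) \<or> up_walk n (rev (y # zs))" by simp
  obtain i k where xy: "x = (i, 0)" "y = (k, 0)" using "3.prems"(3) by (metis insertI1 list.set(2) insertI2 prod.collapse)
  have ik: "i < n" "k < n" "k = (i + 1) mod n \<or> i = (k + 1) mod n"
    using "3.prems"(1) xy by (auto simp: sun_edge_iff)
  show ?case
  proof (cases zs)
    case Nil
    then show ?thesis using xy ik by (auto simp: up_walk_def)
  next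
    case (Cons z us)
    obtain m where z: "z = (m, 0)" using "3.prems"(3) Cons by (metis insertI1 list.set(2) insertI2 prod.collapse)
    have "m \<noteq> i" using "3.prems"(2) Cons z xy by auto
    moreover have "m < n" using "3.prems"(1) xy z Cons by (auto simp: sun_edge_iff)
    moreover have "(i + 1) mod n = (m + 1) mod n \<Longrightarrow> i = m"
      using ik \<open>m < n\<close> by (auto simp: mod_if split: if_splits)
    ultimately show ?thesis using IH ik xy z Cons
      by (auto simp: up_walk_def successively_append_iff)
  qed
qed (auto simp: up_walk_def)

text \<open>\<open>A\<close> and \<open>B\<close> hold the possible pendant ends; as lists they can
  be reversed and exchanged, so the lemma serves both directions of reading a path.\<close>

lemma up_decomposition_eq_sun_walk:
  assumes xs: "xs = A @ ys @ B" and A: "A = [] \<or> (\<exists>p. A = [p] \<and> 0 < snd p)"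
    and B: "B = [] \<or> (\<exists>p. B = [p] \<and> 0 < snd p)"
    and ys: "ys \<noteq> []" "up_walk n ys" "\<And>y. y \<in> set ys \<Longrightarrow> snd y = 0 \<and> fst y < n"
    and adj: "successively (\<lambda>x y. {x, y} \<in> edges (sun n t)) xs"
  shows "\<exists>i a b. i < n \<and> a \<le> t \<and> b \<le> t \<and> xs = sun_walk (length xs) n i a b"
proof -
  define i where "i = fst (hd ys)"
  define a where "a = (if A = [] then 0 else snd (hd A))"
  define b where "b = (if B = [] then 0 else snd (hd B))"
  have yc: "ys = core_walk n i (length ys)" using up_walk_eq_core_walk ys unfolding i_def by blast
  have i: "i < n" using ys unfolding i_def by simp
  have hd: "hd ys = (i, 0)" using ys(3)[of "hd ys"] ys(1) by (simp add: i_def prod_eq_iff)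
  have "i + (length ys - 1) = i + length ys - 1" using ys(1) by (cases ys) auto
  then have last: "last ys = ((i + length ys - 1) mod n, 0)"
    by (subst yc) (use ys(1) in \<open>simp add: core_walk_def last_map\<close>)
  have A': "A = (if 0 < a then [(i, a)] else [])" "a \<le> t"
    using A adj hd ys(1) unfolding xs a_def
    by (auto simp: successively_append_iff sun_edge_iff)
  have B': "B = (if 0 < b then [((i + length ys - 1) mod n, b)] else [])" "b \<le> t"
    using B adj last ys(1) unfolding xs b_def
    by (auto simp: successively_append_iff sun_edge_iff)
  have "length xs = (if 0 < a then 1 else 0) + length ys + (if 0 < b then 1 else 0)"
    unfolding xs by (subst A', subst B') auto
  then have "core_len (length xs) a b = length ys" by (auto simp: core_len_def)
  moreover have "xs = (if 0 < a then [(i, a)] else []) @ core_walk n i (length ys) @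
      (if 0 < b then [((i + length ys - 1) mod n, b)] else [])"
    unfolding A'(1)[symmetric] B'(1)[symmetric] yc[symmetric] by (rule xs)
  ultimately have "xs = sun_walk (length xs) n i a b" by (simp only: sun_walk_def)
  then show ?thesis using i A'(2) B'(2) by blast
qed

lemma path_eq_sun_walk:
  assumes adj: "successively (\<lambda>x y. {x, y} \<in> edges (sun n t)) xs" and d: "distinct xs"
    and len: "3 \<le> length xs" and vs: "set xs \<subseteq> verts (sun n t)"
  shows "\<exists>i a b. i < n \<and> a \<le> t \<and> b \<le> t \<and>
    (xs = sun_walk (length xs) n i a b \<or> rev xs = sun_walk (length xs) n i a b)"
proof -
  obtain x xs' where 1: "xs = x # xs'" using len by (cases xs) auto
  then obtain zs y where "xs' = zs @ [y]" using len by (cases xs' rule: rev_cases) auto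
  with 1 have xs: "xs = x # zs @ [y]" by simp
  have zs: "zs \<noteq> []" using len xs by auto
  \<comment> \<open>A pendant vertex has one neighbour only; inside a path it would have that
    neighbour on both sides, against distinctness.\<close>
  have inner: "snd z = 0" if zzs: "z \<in> set zs" for z
  proof (rule ccontr)
    assume z: "snd z \<noteq> 0"
    obtain us vs where split: "zs = us @ z # vs" using zzs by (meson split_list)
    define u where "u = last (x # us)"
    define v where "v = hd (vs @ [y])"
    have eq: "xs = (x # us) @ [z] @ (vs @ [y])" using xs split by simp
    have "{u, z} \<in> edges (sun n t)" "{z, v} \<in> edges (sun n t)"
      using adj unfolding eq u_def v_def
      by (auto simp: successively_append_iff successively_Cons split: if_splits)
    then have "u = (fst z, 0)" "v = (fst z, 0)"
      using z by (cases u; cases v; cases z; auto simp: sun_edge_iff)+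
    moreover have "u \<in> set (x # us)" "v \<in> set (vs @ [y])"
      unfolding u_def v_def by (rule last_in_set, simp) (rule hd_in_set, simp)
    ultimately show False using d unfolding eq by auto
  qed
  define A where "A = (if snd x = 0 then [] else [x])"
  define B where "B = (if snd y = 0 then [] else [y])"
  define ys where "ys = (if snd x = 0 then [x] else []) @ zs @ (if snd y = 0 then [y] else [])"
  have eq: "xs = A @ ys @ B" unfolding A_def B_def ys_def xs by auto
  have eq': "rev xs = rev B @ rev ys @ rev A" using eq by simp
  have ys: "ys \<noteq> []" "snd w = 0 \<and> fst w < n" if "w \<in> set ys" for w
  proof -
    show "snd w = 0 \<and> fst w < n"
      using that inner vs eq unfolding ys_def by (auto simp: sun_def split: if_splits)
  qed (use zs ys_def in auto)
  have ysne: "ys \<noteq> []" using zs ys_def by auto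
  have adj': "successively (\<lambda>x y. {x, y} \<in> edges (sun n t)) (rev xs)"
    using adj by (simp add: insert_commute)
  have AB: "A = [] \<or> (\<exists>p. A = [p] \<and> 0 < snd p)" "B = [] \<or> (\<exists>p. B = [p] \<and> 0 < snd p)"
    "rev A = [] \<or> (\<exists>p. rev A = [p] \<and> 0 < snd p)" "rev B = [] \<or> (\<exists>p. rev B = [p] \<and> 0 < snd p)"
    unfolding A_def B_def by (auto simp del: split_paired_Ex)
  have "up_walk n ys \<or> up_walk n (rev ys)"
    by (rule cycle_walk_up_or_down[of n t])
      (use adj d ys in \<open>auto simp: eq successively_append_iff\<close>)
  then show ?thesis
  proof
    assume "up_walk n ys"
    from up_decomposition_eq_sun_walk[OF eq AB(1,2) ysne this ys(2) adj] show ?thesis by blast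
  next
    assume up: "up_walk n (rev ys)"
    have "rev ys \<noteq> []" "\<And>w. w \<in> set (rev ys) \<Longrightarrow> snd w = 0 \<and> fst w < n" using ysne ys(2) by auto
    from up_decomposition_eq_sun_walk[OF eq' AB(4,3) this(1) up this(2) adj'] show ?thesis by auto
  qed
qed

lemma paths_sun_eq_codes:
  assumes r: "3 \<le> r" "r \<le> n"
  shows "paths r (sun n t) = (\<lambda>(i, a, b). path_graph (sun_walk r n i a b)) ` sun_codes r n t"
proof
  show "(\<lambda>(i, a, b). path_graph (sun_walk r n i a b)) ` sun_codes r n t \<subseteq> paths r (sun n t)"
    using sun_walk_path r by auto
  show "paths r (sun n t) \<subseteq> (\<lambda>(i, a, b). path_graph (sun_walk r n i a b)) ` sun_codes r n t"
  proof
    fix P assume "P \<in> paths r (sun n t)"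
    then obtain xs where xs: "distinct xs" "P = path_graph xs" "verts P \<subseteq> verts (sun n t)"
      "edges P \<subseteq> edges (sun n t)" "card (verts P) = r"
      by (auto simp: paths_def subgraph_def is_path_def)
    have len: "length xs = r" using xs by (simp add: path_graph_def distinct_card)
    have set: "set xs \<subseteq> verts (sun n t)" using xs by (simp add: path_graph_def)
    have "successively (\<lambda>x y. {x, y} \<in> edges (sun n t)) xs"
      using xs edges_path_graph_subset_iff by blast
    from path_eq_sun_walk[OF this xs(1)] len r set obtain i a b where
      c: "i < n" "a \<le> t" "b \<le> t" "xs = sun_walk r n i a b \<or> rev xs = sun_walk r n i a b" by blast
    have P: "P = path_graph (sun_walk r n i a b)" using c(4) xs(2) path_graph_rev by metis
    have dist: "distinct (sun_walk r n i a b)" using c(4) xs(1) by (metis distinct_rev)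
    show "P \<in> (\<lambda>(i, a, b). path_graph (sun_walk r n i a b)) ` sun_codes r n t"
    \<comment> \<open>Only here can the labels come in the wrong order for a code; exchanging them
      reverses the walk and leaves the path unchanged.\<close>
    proof (cases "r = 3 \<and> 0 < a \<and> 0 < b")
      case True
      then have l: "core_len r a b = 1" "core_len r b a = 1" by (auto simp: core_len_def)
      have "a \<noteq> b" using dist True c l by (auto simp: sun_walk_def core_walk_def)
      moreover have "sun_walk r n i b a = rev (sun_walk r n i a b)"
        using True c l by (auto simp: sun_walk_def core_walk_def)
      then have "P = path_graph (sun_walk r n i b a)" using P path_graph_rev by metis
      ultimately have "(i, a, b) \<in> sun_codes r n t \<or> (i, b, a) \<in> sun_codes r n t"
        using c(1-3) by (auto simp: sun_codes_def)
      then show ?thesis using P \<open>P = path_graph (sun_walk r n i b a)\<close>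
        by (elim disjE; intro image_eqI) auto
    next
      case False
      then have "(i, a, b) \<in> sun_codes r n t" using c(1-3) by (auto simp: sun_codes_def)
      then show ?thesis using P by (intro image_eqI) auto
    qed
  qed
qed

subsection \<open>Intersecting families of paths\<close>

lemma card_le_card_mult:
  assumes "finite I" "X \<subseteq> (\<Union>i\<in>I. F i)" "\<And>i. i \<in> I \<Longrightarrow> finite (F i) \<and> card (F i) \<le> k"
  shows "card X \<le> card I * k"
proof -
  have "card X \<le> card (\<Union>i\<in>I. F i)" using assms by (intro card_mono) auto
  also have "\<dots> \<le> (\<Sum>i\<in>I. card (F i))" by (rule card_UN_le[OF assms(1)])
  also have "\<dots> \<le> (\<Sum>i\<in>I. k)" using assms(3) by (intro sum_mono) auto
  finally show ?thesis by simp
qed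

lemma card_increasing_pairs: "card {(a, b). a \<in> {1..t} \<and> b \<in> {1..t} \<and> a < b} = t choose 2"
proof (induction t)
  case (Suc t)
  have "{(a, b). a \<in> {1..Suc t} \<and> b \<in> {1..Suc t} \<and> a < b} =
      {(a, b). a \<in> {1..t} \<and> b \<in> {1..t} \<and> a < b} \<union> {1..t} \<times> {Suc t}"
    by auto
  moreover have "finite {(a, b). a \<in> {1..t} \<and> b \<in> {1..t} \<and> a < b}"
    by (rule finite_subset[of _ "{1..t} \<times> {1..t}"]) auto
  ultimately show ?case using Suc
    by (simp add: card_Un_disjoint disjoint_iff numeral_2_eq_2)
qed simp

definition pendant_pairs :: "nat \<Rightarrow> nat \<Rightarrow> (nat \<times> nat) set" where
  "pendant_pairs r t = {(a, b). a \<in> {1..t} \<and> b \<in> {1..t} \<and> (r = 3 \<longrightarrow> a < b)}"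

lemma pendant_pairs_subset: "pendant_pairs r t \<subseteq> {1..t} \<times> {1..t}"
  by (auto simp: pendant_pairs_def)

lemma finite_pendant_pairs: "finite (pendant_pairs r t)"
  using pendant_pairs_subset by (rule finite_subset) simp

lemma card_pendant_pairs: "card (pendant_pairs r t) = (if r = 3 then t choose 2 else t\<^sup>2)"
proof (cases "r = 3")
  case False
  then have "pendant_pairs r t = {1..t} \<times> {1..t}" by (auto simp: pendant_pairs_def)
  then show ?thesis using False by (simp add: power2_eq_square)
qed (use card_increasing_pairs in \<open>simp add: pendant_pairs_def\<close>)

lemma cdiff_end:
  assumes "i < n" "1 \<le> l" "l \<le> n"
  shows "cdiff n i ((i + l - 1) mod n) = l - 1"
  using cdiff_add[of i n "l - 1"] assms by simp

text \<open>A path without pendant vertices lies in the cycle, so the pendant vertices of the other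
  path cannot help the intersection.\<close>

lemma card_core_Int:
  assumes "i < n" "k < n" "r \<le> n"
  shows "card (set (sun_walk r n i 0 0) \<inter> set (sun_walk r n k a b)) =
    card (arc n i r \<inter> arc n k (core_len r a b))"
proof -
  have "set (sun_walk r n i 0 0) \<inter> set (sun_walk r n k a b) =
      (arc n i r \<inter> arc n k (core_len r a b)) \<times> {0}"
    using assms by (auto simp: set_sun_walk core_len_def[of r 0 0] split: if_splits)
  then show ?thesis by (simp add: card_cartesian_product)
qed

text \<open>The cores have equal length and different starting points, so they differ at both ends:
  two left or two right pendant vertices never coincide. What remains is a right one equal to a left
  one, where the cores touch end to start; this is \<open>d = l - 1\<close> or
  \<open>n - d = l - 1\<close>.\<close>

lemma card_same_type_Int_le:
  assumes ik: "i < n" "k < n" "i \<noteq> k" and r: "3 \<le> r" "r \<le> n"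
    and type: "0 < a \<longleftrightarrow> 0 < a'" "0 < b \<longleftrightarrow> 0 < b'"
  defines "l \<equiv> core_len r a b" and "d \<equiv> cdiff n i k"
  shows "card (set (sun_walk r n i a b) \<inter> set (sun_walk r n k a' b')) \<le>
    (l - d) + (l - (n - d)) + (if 0 < b \<and> b = a' \<and> d = l - 1 then 1 else 0)
      + (if 0 < a \<and> a = b' \<and> n - d = l - 1 then 1 else 0)"
proof -
  let ?V = "set (sun_walk r n i a b)" and ?W = "set (sun_walk r n k a' b')"
  define Q where "Q = (if 0 < b \<and> b = a' \<and> d = l - 1 then {(k, a')} else {})"
  define R where "R = (if 0 < a \<and> a = b' \<and> n - d = l - 1 then {(i, a)} else {})"
  have l': "core_len r a' b' = l" using type by (auto simp: l_def core_len_def)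
  have l: "1 \<le> l" "l \<le> n" using core_len_bounds[of r a b] r by (auto simp: l_def)
  have e: "(i + l - 1) mod n = k \<Longrightarrow> d = l - 1" "(k + l - 1) mod n = i \<Longrightarrow> n - d = l - 1"
    using cdiff_end[of i n l] cdiff_end[of k n l] cdiff_swap[of i n k] ik l by (auto simp: d_def)
  have ee: "(i + l - 1) mod n \<noteq> (k + l - 1) mod n"
  proof
    assume "(i + l - 1) mod n = (k + l - 1) mod n"
    then have "(l - 1 + i) mod n = (l - 1 + k) mod n" using l by (simp add: add.commute)
    then show False using cdiff_add[of "l - 1" n] ik l
      by (metis One_nat_def Suc_le_lessD diff_less_mono2 diff_less less_le_trans zero_less_one)
  qed
  have "?V \<inter> ?W \<subseteq> (arc n i l \<inter> arc n k l) \<times> {0} \<union> (Q \<union> R)"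
    using e ee ik unfolding set_sun_walk[OF ik(1) r(2)] set_sun_walk[OF ik(2) r(2)] l' l_def[symmetric]
    by (auto simp: Q_def R_def split: if_splits)
  then have "card (?V \<inter> ?W) \<le> card ((arc n i l \<inter> arc n k l) \<times> {0::nat} \<union> (Q \<union> R))"
    by (intro card_mono) (auto simp: finite_arc Q_def R_def)
  also have "\<dots> \<le> card ((arc n i l \<inter> arc n k l) \<times> {0::nat}) + (card Q + card R)"
    by (meson add_left_mono card_Un_le le_trans)
  also have "\<dots> \<le> (l - d) + (l - (n - d)) + (card Q + card R)"
    using card_arc_Int_le[OF ik(1,2), of l l] by (simp add: d_def card_cartesian_product)
  also have "card Q = (if 0 < b \<and> b = a' \<and> d = l - 1 then 1 else 0)" by (simp add: Q_def)
  also have "card R = (if 0 < a \<and> a = b' \<and> n - d = l - 1 then 1 else 0)" by (simp add: R_def)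
  finally show ?thesis by (simp only: add.assoc)
qed

lemma near_if_card_arc_Int:
  assumes "i < n" "k < n" "2 * l + 1 \<le> n + s" "1 \<le> s" "s \<le> card (arc n i l \<inter> arc n k l)"
  shows "near n (l - s) i k"
proof -
  have "s \<le> (l - cdiff n i k) + (l - (n - cdiff n i k))"
    using le_trans[OF assms(5) card_arc_Int_le] assms(1,2) by blast
  then show ?thesis using assms(3,4) cdiff_less[OF assms(1,2)] unfolding near_def by linarith
qed

text \<open>The third assumption is the floor hypothesis on \<open>r\<close>, cleared of its
  denominator.\<close>

locale sun_setting =
  fixes n r s t :: nat
  assumes s: "1 \<le> s" and r: "s + 2 \<le> r" and n: "2 * r + 1 \<le> n + s"
begin

lemma bounds: "3 \<le> r" "r < n" "2 * (r - s) + 2 \<le> n"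
  using s r n by auto

text \<open>Without a shared pendant vertex, one piece of the overlap has \<open>s\<close> vertices
  by itself. With one, both paths have two pendant vertices, so \<open>l = r - 2\<close> and the
  touching cores leave room only for \<open>s \<le> 2\<close>; for \<open>s = 1\<close> the distance
  \<open>l - 1\<close> is near anyway.\<close>

lemma near_or_conflict:
  assumes ik: "i < n" "k < n" "i \<noteq> k" and type: "0 < a \<longleftrightarrow> 0 < a'" "0 < b \<longleftrightarrow> 0 < b'"
    and int: "s \<le> card (set (sun_walk r n i a b) \<inter> set (sun_walk r n k a' b'))"
  defines "l \<equiv> core_len r a b" and "d \<equiv> cdiff n i k"
  shows "near n (l - s) i k \<or>
    s = 2 \<and> 0 < a \<and> 0 < b \<and> (b = a' \<and> d = l - 1 \<or> a = b' \<and> n - d = l - 1)"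
proof -
  have d: "0 < d" "d < n" using cdiff_less cdiff_eq_0_iff ik unfolding d_def by (blast, blast)
  define q where "q \<longleftrightarrow> 0 < b \<and> b = a' \<and> d = l - 1"
  define q' where "q' \<longleftrightarrow> 0 < a \<and> a = b' \<and> n - d = l - 1"
  have card: "s \<le> (l - d) + (l - (n - d)) + (if q then 1 else 0) + (if q' then 1 else 0)"
    unfolding q_def q'_def
    using le_trans[OF int card_same_type_Int_le[OF ik _ _ type]] bounds unfolding l_def d_def by simp
  have l: "1 \<le> l" "l \<le> r" "0 < a \<and> 0 < b \<Longrightarrow> l + 2 = r"
    using core_len_bounds bounds unfolding l_def by (auto simp: core_len_def)
  show ?thesis
  proof (cases "q \<or> q'")
    case True
    then have ab: "0 < a" "0 < b" using type by (auto simp: q_def q'_def)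
    then have lr: "2 * l + 5 \<le> n + s" using l n by auto
    have "d = l - 1 \<or> n - d = l - 1" using True by (auto simp: q_def q'_def)
    moreover define x y :: nat where "x = (if q then 1 else 0)" and "y = (if q' then 1 else 0)"
    moreover have "x \<le> 1" "y \<le> 1" "x = 0 \<or> d = l - 1" "y = 0 \<or> n - d = l - 1"
      unfolding x_def y_def q_def q'_def by simp_all
    ultimately have "s \<le> 2"
      using card lr d l(1) unfolding x_def[symmetric] y_def[symmetric] by (elim disjE) linarith+
    show ?thesis
    proof (cases "s = 2")
      case True
      then show ?thesis using \<open>q \<or> q'\<close> ab by (auto simp: q_def q'_def)
    next
      case False
      then have "s = 1" using s \<open>s \<le> 2\<close> by simp
      then show ?thesis using \<open>d = l - 1 \<or> n - d = l - 1\<close> d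
        unfolding near_def d_def[symmetric] by linarith
    qed
  next
    case False
    then have "s \<le> (l - d) + (l - (n - d))" using card by simp
    then show ?thesis using n l s d unfolding near_def d_def[symmetric] by linarith
  qed
qed

end

section \<open>Counting an intersecting family by its labels\<close>

locale sun_family = sun_setting +
  fixes H :: "(nat \<times> nat) graph set"
  assumes H: "H \<subseteq> paths r (sun n t)" and int: "s_intersecting s H"
begin

definition codes :: "(nat \<times> nat \<times> nat) set" where
  "codes = {(i, a, b) \<in> sun_codes r n t. path_graph (sun_walk r n i a b) \<in> H}"

definition starts :: "nat \<Rightarrow> nat \<Rightarrow> nat set" where
  "starts a b = {i. (i, a, b) \<in> codes}"

definition double_codes :: "(nat \<times> nat \<times> nat) set" where
  "double_codes = {(i, a, b) \<in> codes. 0 < a \<and> 0 < b}"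

lemma codes_bounds: "(i, a, b) \<in> codes \<Longrightarrow> i < n \<and> a \<le> t \<and> b \<le> t"
  by (auto simp: codes_def sun_codes_def)

lemma codes_pendant_pairs: "(i, a, b) \<in> codes \<Longrightarrow> 0 < a \<Longrightarrow> 0 < b \<Longrightarrow> (a, b) \<in> pendant_pairs r t"
  by (auto simp: codes_def sun_codes_def pendant_pairs_def)

lemma finite_codes: "finite codes"
  by (rule finite_subset[of _ "{..<n} \<times> {..t} \<times> {..t}"]) (auto simp: codes_def sun_codes_def)

lemma starts_subset: "starts a b \<subseteq> {..<n}"
  using codes_bounds by (auto simp: starts_def)

lemma finite_starts: "finite (starts a b)"
  using starts_subset by (rule finite_subset) simp

lemma H_eq: "H = (\<lambda>(i, a, b). path_graph (sun_walk r n i a b)) ` codes"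
proof -
  have "3 \<le> r" "r \<le> n" using bounds by auto
  then have "H \<subseteq> (\<lambda>(i, a, b). path_graph (sun_walk r n i a b)) ` sun_codes r n t"
    using H by (simp add: paths_sun_eq_codes)
  show ?thesis
  proof (intro set_eqI iffI)
    fix P assume P: "P \<in> H"
    with \<open>H \<subseteq> _\<close> obtain i a b where "(i, a, b) \<in> sun_codes r n t" "P = path_graph (sun_walk r n i a b)"
      by auto
    with P show "P \<in> (\<lambda>(i, a, b). path_graph (sun_walk r n i a b)) ` codes"
      by (intro image_eqI[of _ _ "(i, a, b)"]) (auto simp: codes_def)
  qed (auto simp: codes_def)
qed

lemma codes_int:
  assumes "(i, a, b) \<in> codes" "(k, a', b') \<in> codes"
  shows "s \<le> card (set (sun_walk r n i a b) \<inter> set (sun_walk r n k a' b'))"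
proof -
  have "path_graph (sun_walk r n i a b) \<in> H" "path_graph (sun_walk r n k a' b') \<in> H"
    using assms by (auto simp: codes_def)
  then have "s \<le> card (verts (path_graph (sun_walk r n i a b)) \<inter> verts (path_graph (sun_walk r n k a' b')))"
    using int unfolding s_intersecting_def by blast
  then show ?thesis by (simp add: path_graph_def)
qed

lemma codes_near_or_conflict:
  assumes "(i, a, b) \<in> codes" "(k, a', b') \<in> codes" "i \<noteq> k" "0 < a \<longleftrightarrow> 0 < a'" "0 < b \<longleftrightarrow> 0 < b'"
  shows "near n (core_len r a b - s) i k \<or> s = 2 \<and> 0 < a \<and> 0 < b \<and>
    (b = a' \<and> cdiff n i k = core_len r a b - 1 \<or> a = b' \<and> n - cdiff n i k = core_len r a b - 1)"
  using near_or_conflict[OF _ _ assms(3-5) codes_int[OF assms(1,2)]] codes_bounds[OF assms(1)]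
    codes_bounds[OF assms(2)] by blast

lemma near_refl: "i < n \<Longrightarrow> near n m i i"
  by (simp add: near_def cdiff_def)

text \<open>With the labels fixed, a conflict requires the right label of a path to equal its own
  left label, so only \<open>a = b\<close> has to be excluded for \<open>s = 2\<close>.\<close>

lemma card_starts_le:
  assumes "\<not> (s = 2 \<and> 0 < a \<and> 0 < b \<and> a = b)"
  shows "card (starts a b) \<le> core_len r a b - s + 1"
proof (rule near_card_le[OF starts_subset])
  fix i k assume "i \<in> starts a b" "k \<in> starts a b"
  then show "near n (core_len r a b - s) i k"
    using codes_near_or_conflict[of i a b k a b] near_refl[of i] assms codes_bounds
    by (cases "i = k") (auto simp: starts_def)
qed (use bounds core_len_bounds(1)[of r a b] in linarith)

lemma card_single_le:
  shows "card {(i, a, b) \<in> codes. 0 < a \<and> b = 0} \<le> t * (r - s)"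
    and "card {(i, a, b) \<in> codes. a = 0 \<and> 0 < b} \<le> t * (r - s)"
proof -
  have l: "core_len r x 0 - s + 1 = r - s" "core_len r 0 x - s + 1 = r - s" if "0 < x" for x
    using that r by (auto simp: core_len_def)
  have "card {(i, a, b) \<in> codes. 0 < a \<and> b = 0} \<le> card {1..t} * (r - s)"
  proof (rule card_le_card_mult)
    show "{(i, a, b) \<in> codes. 0 < a \<and> b = 0} \<subseteq> (\<Union>x\<in>{1..t}. (\<lambda>i. (i, x, 0)) ` starts x 0)"
    proof clarify
      fix i x assume "(i, x, 0) \<in> codes" "0 < x"
      then have "x \<in> {1..t}" "i \<in> starts x 0" using codes_bounds by (auto simp: starts_def)
      then show "(i, x, 0) \<in> (\<Union>x\<in>{1..t}. (\<lambda>i. (i, x, 0)) ` starts x 0)" by blast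
    qed
    fix x assume "x \<in> {1..t}"
    then show "finite ((\<lambda>i. (i, x, 0)) ` starts x 0) \<and> card ((\<lambda>i. (i, x, 0)) ` starts x 0) \<le> r - s"
      using card_starts_le[of x 0] l(1)[of x] finite_starts by (auto simp: card_image inj_on_def)
  qed simp
  moreover have "card {(i, a, b) \<in> codes. a = 0 \<and> 0 < b} \<le> card {1..t} * (r - s)"
  proof (rule card_le_card_mult)
    show "{(i, a, b) \<in> codes. a = 0 \<and> 0 < b} \<subseteq> (\<Union>x\<in>{1..t}. (\<lambda>i. (i, 0, x)) ` starts 0 x)"
    proof clarify
      fix i x assume "(i, 0, x) \<in> codes" "0 < x"
      then have "x \<in> {1..t}" "i \<in> starts 0 x" using codes_bounds by (auto simp: starts_def)
      then show "(i, 0, x) \<in> (\<Union>x\<in>{1..t}. (\<lambda>i. (i, 0, x)) ` starts 0 x)" by blast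
    qed
    fix x assume "x \<in> {1..t}"
    then show "finite ((\<lambda>i. (i, 0, x)) ` starts 0 x) \<and> card ((\<lambda>i. (i, 0, x)) ` starts 0 x) \<le> r - s"
      using card_starts_le[of 0 x] l(2)[of x] finite_starts by (auto simp: card_image inj_on_def)
  qed simp
  ultimately show "card {(i, a, b) \<in> codes. 0 < a \<and> b = 0} \<le> t * (r - s)"
    "card {(i, a, b) \<in> codes. a = 0 \<and> 0 < b} \<le> t * (r - s)" by simp_all
qed

lemma double_codes_mult:
  assumes "\<And>a b. (a, b) \<in> pendant_pairs r t \<Longrightarrow> card (starts a b) \<le> m"
  shows "card double_codes \<le> card (pendant_pairs r t) * m"
proof (rule card_le_card_mult[OF finite_pendant_pairs])
  show "double_codes \<subseteq> (\<Union>p\<in>pendant_pairs r t. (\<lambda>i. (i, p)) ` starts (fst p) (snd p))"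
    using codes_pendant_pairs by (fastforce simp: double_codes_def starts_def)
  fix p assume "p \<in> pendant_pairs r t"
  then show "finite ((\<lambda>i. (i, p)) ` starts (fst p) (snd p)) \<and>
      card ((\<lambda>i. (i, p)) ` starts (fst p) (snd p)) \<le> m"
    using assms[of "fst p" "snd p"] finite_starts by (auto simp: card_image inj_on_def)
qed

lemma core_len_double: "0 < a \<Longrightarrow> 0 < b \<Longrightarrow> core_len r a b = r - 2"
  by (simp add: core_len_def)

text \<open>For \<open>s = 2\<close> two paths with pendant vertices at both ends may share just one cycle vertex and
  its pendant vertex. Then the starting points can form an extremal family for intersection \<open>1\<close>,
  but the two outermost cores \<open>c\<close> and \<open>c'\<close> meet in one vertex only, which fixes the label there
  and costs more than the additional core gains, provided that \<^prop>\<open>2 \<le> t\<close>.\<close>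

lemma card_double_codes_two:
  assumes s2: "s = 2" and t: "2 \<le> t"
  shows "card double_codes \<le> t\<^sup>2 * (r - 3)"
proof -
  define l where "l = r - 2"
  have l: "2 \<le> l" "r - 3 = l - 1" "2 * (l - 1) + 3 \<le> n" "l < n" using r s2 n by (auto simp: l_def)
  \<comment> \<open>Starting points are collected regardless of labels. Conflicts allow distance
    \<open>l - 1\<close>, so there may be \<open>l\<close> of them, one more than the bound can
    afford with all labels free.\<close>
  define U where "U = fst ` double_codes"
  have U: "U \<subseteq> {..<n}" using codes_bounds by (auto simp: U_def double_codes_def)
  then have finU: "finite U" by (rule finite_subset) simp
  have near: "near n (l - 1) i k" if ik: "i \<in> U" "k \<in> U" for i k
  proof (cases "i = k")
    case True
    then show ?thesis using near_refl U that by auto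
  next
    case False
    obtain a b a' b' where "(i, a, b) \<in> double_codes" "(k, a', b') \<in> double_codes"
      using ik by (auto simp: U_def)
    then have c: "(i, a, b) \<in> codes" "(k, a', b') \<in> codes" "0 < a" "0 < b" "0 < a'" "0 < b'"
      by (auto simp: double_codes_def)
    then have "near n (l - s) i k \<or> cdiff n i k = l - 1 \<or> n - cdiff n i k = l - 1"
      using codes_near_or_conflict[OF c(1,2) False] core_len_double by (auto simp: l_def)
    then show ?thesis using s2 unfolding near_def by linarith
  qed
  let ?T = "{1..t} \<times> {1..t}"
  have fib: "double_codes \<subseteq> (\<Union>i\<in>U. {i} \<times> ?T)"
    using codes_bounds by (force simp: U_def double_codes_def)
  have "card U \<le> l"
    using near_card_le[OF U near] l by simp
  show ?thesis
  proof (cases "card U \<le> l - 1")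
    case True
    have "card double_codes \<le> card U * t\<^sup>2"
      by (rule card_le_card_mult[OF finU fib]) (simp add: power2_eq_square)
    also have "\<dots> \<le> (l - 1) * t\<^sup>2" using True by (rule mult_right_mono) simp
    finally show ?thesis using l by (simp add: mult.commute)
  next
    case False
    then have "card U = l - 1 + 1" using \<open>card U \<le> l\<close> l by simp
    from near_card_eq[OF U near l(3) this] obtain c
      where c: "c < n" "U = (\<lambda>x. (c + x) mod n) ` {..l - 1}" by blast
    define c' where "c' = (c + (l - 1)) mod n"
    have cU: "c \<in> U" "c' \<in> U" unfolding c(2) c'_def using c(1)
      by (auto intro: image_eqI[of _ _ 0] image_eqI[of _ _ "l - 1"])
    have d: "cdiff n c c' = l - 1" unfolding c'_def using cdiff_add[of c n "l - 1"] c l by simp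
    have cc': "c \<noteq> c'" using d l by (auto simp: cdiff_def)
    \<comment> \<open>\<open>c\<close> and \<open>c'\<close> are too far apart to be near for
      \<open>l - 2\<close>, hence in conflict. The alternative
      \<open>n - cdiff n c c' = l - 1\<close> would mean \<open>n = 2 * l - 2\<close>, which is too
      small.\<close>
    have conf: "b = a'" if "(c, a, b) \<in> double_codes" "(c', a', b') \<in> double_codes" for a b a' b'
    proof -
      have "core_len r a b = l" using that core_len_double by (auto simp: double_codes_def l_def)
      then show ?thesis
        using codes_near_or_conflict[of c a b c' a' b'] that cc' s2 l d
        by (auto simp: double_codes_def near_def)
    qed
    obtain a b a' b' where ab: "(c, a, b) \<in> double_codes" "(c', a', b') \<in> double_codes"
      using cU by (auto simp: U_def)
    have sub: "double_codes \<subseteq> (\<Union>i\<in>U - {c, c'}. {i} \<times> ?T) \<union> ({c} \<times> {1..t} \<times> {b} \<union> {c'} \<times> {b} \<times> {1..t})"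
    proof
      fix x assume x: "x \<in> double_codes"
      obtain i u v where iuv: "x = (i, u, v)" by (cases x)
      then have "i \<in> U" "u \<in> {1..t}" "v \<in> {1..t}" using fib x by auto
      moreover have "i = c \<Longrightarrow> v = b" using conf[of u v] conf[OF ab] ab x iuv by blast
      moreover have "i = c' \<Longrightarrow> u = b" using conf[OF ab(1)] x iuv by blast
      ultimately show "x \<in> (\<Union>i\<in>U - {c, c'}. {i} \<times> ?T) \<union> ({c} \<times> {1..t} \<times> {b} \<union> {c'} \<times> {b} \<times> {1..t})"
        using iuv by auto
    qed
    have "card (\<Union>i\<in>U - {c, c'}. {i} \<times> ?T) \<le> card (U - {c, c'}) * t\<^sup>2"
      by (rule card_le_card_mult[OF _ subset_refl]) (simp_all add: finU power2_eq_square)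
    also have "card (U - {c, c'}) = l - 2"
      using cU cc' \<open>card U = l - 1 + 1\<close> finU by (simp add: card_Diff_subset)
    finally have 1: "card (\<Union>i\<in>U - {c, c'}. {i} \<times> ?T) \<le> (l - 2) * t\<^sup>2" .
    have "card double_codes \<le> card ((\<Union>i\<in>U - {c, c'}. {i} \<times> ?T) \<union> ({c} \<times> {1..t} \<times> {b} \<union> {c'} \<times> {b} \<times> {1..t}))"
      by (rule card_mono[OF _ sub]) (use finU in auto)
    also have "\<dots> \<le> card (\<Union>i\<in>U - {c, c'}. {i} \<times> ?T) + card ({c} \<times> {1..t} \<times> {b} \<union> {c'} \<times> {b} \<times> {1..t})"
      by (rule card_Un_le)
    also have "card ({c} \<times> {1..t} \<times> {b} \<union> {c'} \<times> {b} \<times> {1..t}) \<le> t + t"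
      by (rule order_trans[OF card_Un_le]) (simp add: card_cartesian_product)
    \<comment> \<open>By \<open>2 \<le> t\<close>, the two outermost starting points together count
      at most as much as a single one with free labels.\<close>
    also have "card (\<Union>i\<in>U - {c, c'}. {i} \<times> ?T) + (t + t) \<le> (l - 2) * t\<^sup>2 + t * t"
      using 1 t by (intro add_mono) (auto simp: mult_2[symmetric])
    also have "\<dots> = ((l - 2) + 1) * t\<^sup>2" by (simp only: add_mult_distrib power2_eq_square mult_1)
    also have "(l - 2) + 1 = r - 3" using l by simp
    finally show ?thesis by (simp add: mult.commute)
  qed
qed

lemma card_double_codes_le:
  assumes "\<not> (s = 2 \<and> t = 1)"
  shows "card double_codes \<le> card (pendant_pairs r t) * (r - s - 1)"
proof (cases "s = 2 \<and> 2 \<le> t")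
  case True
  then have "r \<noteq> 3" using r by auto
  then show ?thesis using card_double_codes_two True by (simp add: card_pendant_pairs)
next
  case False
  have "card (starts a b) \<le> r - s - 1" if "(a, b) \<in> pendant_pairs r t" for a b
  proof -
    \<comment> \<open>The existence of labels gives \<open>1 \<le> t\<close>; with
      \<open>s = 2\<close> this would leave the excluded \<open>t = 1\<close>.\<close>
    have "0 < a" "0 < b" "s \<noteq> 2" using that False assms by (auto simp: pendant_pairs_def)
    then show ?thesis using card_starts_le[of a b] core_len_double[of a b] r by simp
  qed
  then show ?thesis by (rule double_codes_mult)
qed

text \<open>With a single label the condition \<open>b = a'\<close> of a conflict always holds, so
  distance \<open>r - 3\<close> is allowed. The bound exceeds the share of the star by one;
  \<open>card_H_le_star\<close> makes up for it.\<close>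

lemma card_double_codes_le_exceptional:
  assumes "s = 2" "t = 1"
  shows "card double_codes \<le> r - 2"
proof -
  have "card (starts 1 1) \<le> (r - 3) + 1"
  proof (rule near_card_le[OF starts_subset])
    fix i k assume "i \<in> starts 1 1" "k \<in> starts 1 1"
    then have ik: "(i, 1, 1) \<in> codes" "(k, 1, 1) \<in> codes" by (auto simp: starts_def)
    have l: "core_len r 1 1 = r - 2" by (simp add: core_len_def)
    show "near n (r - 3) i k"
    proof (cases "i = k")
      case True
      then show ?thesis using near_refl codes_bounds ik by blast
    next
      case False
      then have "near n (r - 2 - s) i k \<or> cdiff n i k = r - 3 \<or> n - cdiff n i k = r - 3"
        using codes_near_or_conflict[OF ik False] l by auto
      then show ?thesis using assms unfolding near_def by linarith
    qed
  qed (use n assms r in auto)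
  moreover have "pendant_pairs r t \<subseteq> {(1, 1)}" using assms by (auto simp: pendant_pairs_def)
  ultimately have "card double_codes \<le> card (pendant_pairs r t) * (r - 2)"
    using r assms by (intro double_codes_mult) (auto simp: numeral_3_eq_3 Suc_diff_Suc)
  moreover have "card (pendant_pairs r t) = 1" using assms r by (simp add: card_pendant_pairs)
  ultimately show ?thesis by simp
qed

text \<open>The pendant-free paths stay as \<open>card (starts 0 0)\<close>, so that it can later be
  seen when they must be as many as possible.\<close>

lemma card_H_le: "card H \<le> card (starts 0 0) + 2 * t * (r - s) + card double_codes"
proof -
  have "card H \<le> card codes"
    by (rule ord_eq_le_trans[OF arg_cong[OF H_eq, of card] card_image_le[OF finite_codes]])
  also have "codes = (\<lambda>i. (i, 0, 0)) ` starts 0 0 \<union> ({(i, a, b) \<in> codes. 0 < a \<and> b = 0} \<union>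
      ({(i, a, b) \<in> codes. a = 0 \<and> 0 < b} \<union> double_codes))"
    by (auto simp: starts_def double_codes_def)
  also have "card \<dots> \<le> card ((\<lambda>i. (i, 0::nat, 0::nat)) ` starts 0 0) + (card {(i, a, b) \<in> codes. 0 < a \<and> b = 0} +
      (card {(i, a, b) \<in> codes. a = 0 \<and> 0 < b} + card double_codes))"
    by (meson add_left_mono card_Un_le le_trans)
  also have "card ((\<lambda>i. (i, 0::nat, 0::nat)) ` starts 0 0) = card (starts 0 0)"
    by (rule card_image) (auto simp: inj_on_def)
  finally show ?thesis using card_single_le by linarith
qed

lemma card_starts_core_le: "card (starts 0 0) \<le> r - s + 1"
  using card_starts_le[of 0 0] by (simp add: core_len_def)

section \<open>Families with the maximal number of pendant-free paths\<close>

lemma extremal_common_segment: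
  assumes n': "2 * (r - s) + 3 \<le> n" and card: "card (starts 0 0) = r - s + 1"
  obtains Y where "card Y = s" "Y \<subseteq> {..<n}"
    "\<And>k a b. (k, a, b) \<in> codes \<Longrightarrow> Y \<subseteq> arc n k (core_len r a b)"
proof -
  have near: "near n (r - s) i k" if "i \<in> starts 0 0" "k \<in> starts 0 0" for i k
    using codes_near_or_conflict[of i 0 0 k 0 0] near_refl[of i] that codes_bounds
    by (cases "i = k") (auto simp: starts_def core_len_def)
  from near_card_eq[OF starts_subset near n' card] obtain c
    where c: "c < n" "starts 0 0 = (\<lambda>x. (c + x) mod n) ` {..r - s}" by blast
  \<comment> \<open>The common part of the arcs starting at \<open>c, ..., c + (r - s)\<close>: from
    the start of the last one to the end of the first one.\<close>
  define Y where "Y = (\<lambda>x. (c + x) mod n) ` {r - s..<r}"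
  have "inj_on (\<lambda>x. (c + x) mod n) {r - s..<r}"
  proof (rule inj_onI)
    fix x y assume "x \<in> {r - s..<r}" "y \<in> {r - s..<r}" and eq: "(c + x) mod n = (c + y) mod n"
    then have "x < n" "y < n" using bounds by auto
    then have "cdiff n c ((c + x) mod n) = x" "cdiff n c ((c + y) mod n) = y"
      using cdiff_add c by auto
    then show "x = y" unfolding eq by simp
  qed
  then have "card Y = s" unfolding Y_def using r by (simp add: card_image)
  moreover have "Y \<subseteq> {..<n}" using bounds by (auto simp: Y_def)
  moreover have "Y \<subseteq> arc n k (core_len r a b)" if k: "(k, a, b) \<in> codes" for k a b
    unfolding Y_def
  proof (rule common_segment_subset_arc[OF n s])
    fix x assume "x \<le> r - s"
    then have "(c + x) mod n \<in> starts 0 0" unfolding c(2) by blast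
    then have "s \<le> card (set (sun_walk r n ((c + x) mod n) 0 0) \<inter> set (sun_walk r n k a b))"
      using codes_int[OF _ k] by (simp add: starts_def)
    then show "s \<le> card (arc n ((c + x) mod n) r \<inter> arc n k (core_len r a b))"
      using card_core_Int[of "(c + x) mod n" n k r a b] codes_bounds[OF k] bounds by simp
  qed (use r c codes_bounds[OF k] core_len_bounds in auto)
  ultimately show ?thesis using that by blast
qed

lemma s_star_if_extremal:
  assumes "2 * (r - s) + 3 \<le> n" "card (starts 0 0) = r - s + 1"
  shows "s_star (sun n t) s H"
proof -
  obtain Y where Y: "card Y = s" "Y \<subseteq> {..<n}"
    "\<And>k a b. (k, a, b) \<in> codes \<Longrightarrow> Y \<subseteq> arc n k (core_len r a b)"
    using extremal_common_segment assms by blast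
  have "Y \<times> {0} \<subseteq> verts A" if A: "A \<in> H" for A
  proof -
    obtain k a b where c: "(k, a, b) \<in> codes" "A = path_graph (sun_walk r n k a b)"
      using subsetD[OF equalityD1[OF H_eq] A] by auto
    then show ?thesis using Y(3)[OF c(1)] codes_bounds[OF c(1)] bounds
      by (auto simp: path_graph_def set_sun_walk)
  qed
  moreover have "Y \<times> {0} \<subseteq> verts (sun n t)" using Y(2) by (auto simp: sun_def)
  ultimately have "Y \<times> {0} \<subseteq> verts (sun n t) \<inter> (\<Inter>A\<in>H. verts A)" by blast
  moreover have "finite (verts (sun n t) \<inter> (\<Inter>A\<in>H. verts A))" by (simp add: sun_def)
  ultimately have "card (Y \<times> {0::nat}) \<le> card (verts (sun n t) \<inter> (\<Inter>A\<in>H. verts A))"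
    by (rule card_mono[rotated])
  then show ?thesis using Y(1) by (simp add: s_star_def card_cartesian_product)
qed

text \<open>All cores contain the same two cycle vertices, so touching in one vertex is impossible
  and the extra starting point is lost.\<close>

lemma card_double_codes_le_if_extremal:
  assumes st: "s = 2" "t = 1" and card: "card (starts 0 0) = r - s + 1"
  shows "card double_codes \<le> r - 3"
proof -
  \<comment> \<open>For \<open>s = 2\<close> this is already the general bound on \<open>r\<close>,
    so the extremal starting points are consecutive without the strict inequality.\<close>
  have "2 * (r - s) + 3 \<le> n" using n r st by auto
  then obtain Y where Y: "card Y = s" "Y \<subseteq> {..<n}"
    "\<And>k a b. (k, a, b) \<in> codes \<Longrightarrow> Y \<subseteq> arc n k (core_len r a b)"
    using extremal_common_segment card by blast
  have "card (starts 1 1) \<le> (r - 2 - s) + 1"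
  proof (rule near_card_le[OF starts_subset])
    fix i k assume "i \<in> starts 1 1" "k \<in> starts 1 1"
    then have ik: "(i, 1, 1) \<in> codes" "(k, 1, 1) \<in> codes" by (auto simp: starts_def)
    have "core_len r 1 1 = r - 2" by (simp add: core_len_def)
    then have "Y \<subseteq> arc n i (r - 2) \<inter> arc n k (r - 2)"
      using Y(3)[OF ik(1)] Y(3)[OF ik(2)] by simp
    then have "card Y \<le> card (arc n i (r - 2) \<inter> arc n k (r - 2))"
      by (intro card_mono) (auto simp: finite_arc)
    then show "near n (r - 2 - s) i k"
      using near_if_card_arc_Int[of i n k "r - 2" s] codes_bounds ik s n Y(1) r by simp
  qed (use n st r in auto)
  moreover have "pendant_pairs r t \<subseteq> {(1, 1)}" using st by (auto simp: pendant_pairs_def)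
  ultimately have "card double_codes \<le> card (pendant_pairs r t) * (r - 3)"
    using r st by (intro double_codes_mult) auto
  moreover have "card (pendant_pairs r t) = 1" using st r by (simp add: card_pendant_pairs)
  ultimately show ?thesis by simp
qed

end

subsection \<open>The full star at a segment of the cycle\<close>

lemma arc_no_wrap: "i + l \<le> n \<Longrightarrow> arc n i l = {i..<i + l}"
  by (auto simp: arc_def cdiff_def)

lemma set_sun_walk_no_wrap:
  assumes "3 \<le> r" "i + r \<le> n" "i < n"
  shows "set (sun_walk r n i a b) = {i..<i + core_len r a b} \<times> {0} \<union> (if 0 < a then {(i, a)} else {})
    \<union> (if 0 < b then {(i + core_len r a b - 1, b)} else {})"
proof -
  have l: "1 \<le> core_len r a b" "core_len r a b \<le> r" using core_len_bounds assms by auto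
  then have "(i + core_len r a b - 1) mod n = i + core_len r a b - 1" using assms by simp
  moreover have "r \<le> n" using assms by simp
  ultimately show ?thesis using l assms by (simp add: set_sun_walk arc_no_wrap)
qed

text \<open>The cycle vertices determine \<open>i\<close> and the core length, and the labels are
  read off at the two ends. For a one-vertex core only the set of labels can be read off; the
  increasing order then decides.\<close>

lemma sun_walk_no_wrap_inj:
  assumes r: "3 \<le> r" and i: "i + r \<le> n" "i < n" "i' + r \<le> n" "i' < n"
    and inc: "r = 3 \<Longrightarrow> 0 < a \<Longrightarrow> 0 < b \<Longrightarrow> a < b" "r = 3 \<Longrightarrow> 0 < a' \<Longrightarrow> 0 < b' \<Longrightarrow> a' < b'"
    and eq: "set (sun_walk r n i a b) = set (sun_walk r n i' a' b')"
  shows "i = i' \<and> a = a' \<and> b = b'"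
proof -
  define l l' where "l = core_len r a b" and "l' = core_len r a' b'"
  have l: "1 \<le> l" "1 \<le> l'" using core_len_bounds r by (auto simp: l_def l'_def)
  define V where "V = set (sun_walk r n i a b)"
  have V: "V = {i..<i + l} \<times> {0} \<union> (if 0 < a then {(i, a)} else {}) \<union> (if 0 < b then {(i + l - 1, b)} else {})"
    unfolding V_def l_def by (rule set_sun_walk_no_wrap) (use r i in auto)
  have V': "V = {i'..<i' + l'} \<times> {0} \<union> (if 0 < a' then {(i', a')} else {}) \<union> (if 0 < b' then {(i' + l' - 1, b')} else {})"
    unfolding V_def eq l'_def by (rule set_sun_walk_no_wrap) (use r i in auto)
  have "{x. (x, 0) \<in> V} = {i..<i + l}" unfolding V by auto
  moreover have "{x. (x, 0) \<in> V} = {i'..<i' + l'}" unfolding V' by auto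
  ultimately have "{i..<i + l} = {i'..<i' + l'}" by simp
  then have ii: "i' = i" "l' = l" using l by (auto simp: atLeastLessThan_eq_iff)
  define e where "e = i + l - 1"
  have lab: "0 < x \<Longrightarrow> (y, x) \<in> V \<longleftrightarrow> x = a \<and> y = i \<or> x = b \<and> y = e" for x y
    unfolding V e_def by auto
  have lab': "0 < x \<Longrightarrow> (y, x) \<in> V \<longleftrightarrow> x = a' \<and> y = i \<or> x = b' \<and> y = e" for x y
    unfolding V' e_def ii by auto
  have both: "0 < x \<Longrightarrow> (x = a \<and> y = i \<or> x = b \<and> y = e) \<longleftrightarrow> (x = a' \<and> y = i \<or> x = b' \<and> y = e)" for x y
    using lab lab' by blast
  show ?thesis
  proof (cases "i = e")
    case False
    then have "0 < x \<Longrightarrow> x = a \<longleftrightarrow> x = a'" "0 < x \<Longrightarrow> x = b \<longleftrightarrow> x = b'" for x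
      using both[of x i] both[of x e] by auto
    then have "a = a'" "b = b'" by (metis not_gr_zero)+
    then show ?thesis using ii by simp
  next
    case True
    then have "l = 1" using l by (simp add: e_def)
    then have r3: "r = 3" "0 < a" "0 < b" "0 < a'" "0 < b'"
      using r ii unfolding l_def l'_def by (auto simp: core_len_def split: if_splits)
    then have "a < b" "a' < b'" using inc by auto
    moreover have "a = a' \<or> a = b'" "b = a' \<or> b = b'" "a' = a \<or> a' = b" "b' = a \<or> b' = b"
      using both[of a i] both[of b i] both[of a' i] both[of b' i] True r3 by blast+
    ultimately show ?thesis using ii by auto
  qed
qed

context sun_setting
begin

text \<open>This position lets the counted paths start in \<open>{0..r - s}\<close> and end below
  \<open>n\<close>, so no index is reduced modulo \<open>n\<close>.\<close>

definition star_segment :: "(nat \<times> nat) set" where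
  "star_segment = {r - s..<r} \<times> {0}"

lemma star_segment: "star_segment \<subseteq> verts (sun n t)" "card star_segment = s"
  using bounds r by (auto simp: star_segment_def sun_def card_cartesian_product)

lemma card_full_star_ge:
  "(r - s + 1) + 2 * t * (r - s) + card (pendant_pairs r t) * (r - s - 1)
    \<le> card (full_star (paths r (sun n t)) star_segment)"
proof -
  \<comment> \<open>A core containing the segment starts at \<open>r - s\<close> or earlier and ends
    with \<open>r - 1\<close> or later. Each pendant vertex shortens it by one and so excludes one
    starting point: they begin at \<open>0\<close>, \<open>1\<close> or \<open>2\<close>.\<close>
  define C0 where "C0 = {0..r - s} \<times> {(0::nat, 0::nat)}"
  define CL where "CL = {1..r - s} \<times> ({1..t} \<times> {0::nat})"
  define CR where "CR = {1..r - s} \<times> ({0::nat} \<times> {1..t})"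
  define CD where "CD = {2..r - s} \<times> pendant_pairs r t"
  define C where "C = (C0 \<union> CL) \<union> (CR \<union> CD)"
  have fin: "finite C0" "finite CL" "finite CR" "finite CD"
    by (simp_all add: C0_def CL_def CR_def CD_def finite_pendant_pairs)
  have pp: "0 < a \<and> 0 < b" if "(a, b) \<in> pendant_pairs r t" for a b
    using that by (simp add: pendant_pairs_def)
  have disj: "C0 \<inter> CL = {}" "CR \<inter> CD = {}" "(C0 \<union> CL) \<inter> (CR \<union> CD) = {}"
    unfolding C0_def CL_def CR_def CD_def using pp by fastforce+
  have "card C = card C0 + card CL + (card CR + card CD)"
    unfolding C_def using fin disj by (simp add: card_Un_disjoint)
  also have "\<dots> = (r - s + 1) + 2 * t * (r - s) + card (pendant_pairs r t) * (r - s - 1)"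
    by (simp add: C0_def CL_def CR_def CD_def card_cartesian_product)
  finally have card: "card C = (r - s + 1) + 2 * t * (r - s) + card (pendant_pairs r t) * (r - s - 1)" .
  have C: "i + s \<le> r" "i < n" "i + r \<le> n" "a \<le> t" "b \<le> t" "r \<le> i + core_len r a b"
    "r = 3 \<Longrightarrow> 0 < a \<Longrightarrow> 0 < b \<Longrightarrow> a < b" if "(i, a, b) \<in> C" for i a b
  proof -
    have *: "i + s \<le> r" "a \<le> t" "b \<le> t" "(if 0 < a then 1 else 0) + (if 0 < b then 1 else 0) \<le> i"
      "r = 3 \<Longrightarrow> 0 < a \<Longrightarrow> 0 < b \<Longrightarrow> a < b"
      using that r by (auto simp: C_def C0_def CL_def CR_def CD_def pendant_pairs_def)
    then show "i + s \<le> r" "i < n" "i + r \<le> n" "a \<le> t" "b \<le> t"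
      "r = 3 \<Longrightarrow> 0 < a \<Longrightarrow> 0 < b \<Longrightarrow> a < b"
      using r n s by auto
    show "r \<le> i + core_len r a b" using * r s by (auto simp: core_len_def split: if_splits)
  qed
  let ?P = "\<lambda>(i, a, b). path_graph (sun_walk r n i a b)"
  have "inj_on ?P C"
  proof (rule inj_onI)
    fix x y assume xy: "x \<in> C" "y \<in> C" "?P x = ?P y"
    obtain i a b i' a' b' where e: "x = (i, a, b)" "y = (i', a', b')" by (cases x, cases y) auto
    have "i = i' \<and> a = a' \<and> b = b'"
      by (rule sun_walk_no_wrap_inj[of r i n i' a b a' b'])
        (use xy e C bounds in \<open>auto simp: path_graph_def\<close>)
    then show "x = y" using e by simp
  qed
  then have "card C = card (?P ` C)" by (simp add: card_image)
  also have "\<dots> \<le> card (full_star (paths r (sun n t)) star_segment)"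
  proof (rule card_mono)
    show "finite (full_star (paths r (sun n t)) star_segment)"
      unfolding full_star_def using finite_paths_sun[of r n t] by (rule rev_finite_subset) auto
    show "?P ` C \<subseteq> full_star (paths r (sun n t)) star_segment"
    proof clarify
      fix i a b assume c: "(i, a, b) \<in> C"
      note C = C[OF c]
      have "path_graph (sun_walk r n i a b) \<in> paths r (sun n t)"
        by (rule sun_walk_path) (use C bounds in \<open>auto simp: sun_codes_def\<close>)
      moreover have "star_segment \<subseteq> set (sun_walk r n i a b)"
        using C bounds by (auto simp: star_segment_def set_sun_walk_no_wrap)
      ultimately show "path_graph (sun_walk r n i a b) \<in> full_star (paths r (sun n t)) star_segment"
        by (simp add: full_star_def path_graph_def)
    qed
  qed
  finally show ?thesis using card by simp
qed

end

section \<open>The upper bound, strictness and the explicit formula\<close>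

context sun_family
begin

lemma card_H_le_star:
  "card H \<le> (r - s + 1) + 2 * t * (r - s) + card (pendant_pairs r t) * (r - s - 1)"
proof (cases "s = 2 \<and> t = 1")
  case False
  then show ?thesis using card_H_le card_double_codes_le card_starts_core_le by linarith
next
  case True
  then have "card (pendant_pairs r t) = 1" using r by (simp add: card_pendant_pairs)
  \<comment> \<open>The trade-off for \<open>s = 2\<close>, \<open>t = 1\<close>: all
    \<open>r - s + 1\<close> pendant-free starting points force the smaller bound on
    \<open>double_codes\<close>, and otherwise the missing one pays for the larger bound.\<close>
  moreover have "card (starts 0 0) + card double_codes \<le> (r - s + 1) + (r - s - 1)"
  proof (cases "card (starts 0 0) = r - s + 1")
    case True
    then show ?thesis
      using card_double_codes_le_if_extremal \<open>s = 2 \<and> t = 1\<close> by simp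
  next
    case False
    then show ?thesis
      using card_double_codes_le_exceptional \<open>s = 2 \<and> t = 1\<close> card_starts_core_le r by linarith
  qed
  ultimately show ?thesis using card_H_le by simp
qed

end

context sun_setting
begin

lemma s_intersecting_full_star: "s_intersecting s (full_star (paths r (sun n t)) star_segment)"
proof -
  have "s \<le> card (verts A \<inter> verts B)"
    if AB: "A \<in> full_star (paths r (sun n t)) star_segment" "B \<in> full_star (paths r (sun n t)) star_segment"
    for A B
  proof -
    have "verts A \<subseteq> verts (sun n t)"
      using AB by (simp add: full_star_def paths_def subgraph_def)
    then have "finite (verts A)" by (rule finite_subset) (simp add: sun_def)
    moreover have "star_segment \<subseteq> verts A \<inter> verts B" using AB by (simp add: full_star_def)
    ultimately have "card star_segment \<le> card (verts A \<inter> verts B)" by (intro card_mono) auto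
    then show ?thesis using star_segment(2) by simp
  qed
  then show ?thesis by (simp add: s_intersecting_def)
qed

lemma EKR_sun: "EKR (sun n t) (paths r (sun n t)) s"
  unfolding EKR_def
proof (intro exI conjI allI impI)
  fix H assume "H \<subseteq> paths r (sun n t)" "s_intersecting s H"
  then interpret sun_family n r s t H by unfold_locales
  show "card H \<le> card (full_star (paths r (sun n t)) star_segment)"
    using card_H_le_star card_full_star_ge by (rule le_trans)
qed (rule star_segment)+

text \<open>A family of maximum size is at least as large as the star, while paths with pendant
  vertices contribute at most their share of the star's count. Hence the pendant-free paths must
  attain their own maximum.\<close>

lemma strictly_EKR_sun:
  assumes "2 * r + 2 \<le> n + s" "\<not> (s = 2 \<and> t = 1)"
  shows "strictly_EKR (sun n t) (paths r (sun n t)) s"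
  unfolding strictly_EKR_def
proof (intro conjI allI impI EKR_sun)
  fix H assume H: "H \<subseteq> paths r (sun n t)"
    and max: "s_intersecting s H \<and> (\<forall>K\<subseteq>paths r (sun n t). s_intersecting s K \<longrightarrow> card K \<le> card H)"
  then interpret sun_family n r s t H by unfold_locales auto
  have "full_star (paths r (sun n t)) star_segment \<subseteq> paths r (sun n t)" by (auto simp: full_star_def)
  then have "card (full_star (paths r (sun n t)) star_segment) \<le> card H"
    using max s_intersecting_full_star by blast
  then have "r - s + 1 \<le> card (starts 0 0)"
    using card_full_star_ge card_H_le card_double_codes_le[OF assms(2)] by linarith
  then have "card (starts 0 0) = r - s + 1" using card_starts_core_le by simp
  moreover have "2 * (r - s) + 3 \<le> n" using assms s r by linarith
  ultimately show "s_star (sun n t) s H" by (intro s_star_if_extremal)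
qed

lemma card_le_sun_bound:
  assumes "F \<subseteq> paths r (sun n t)" "s_intersecting s F"
  shows "int (card F) \<le> sun_bound r s t"
proof -
  interpret sun_family n r s t F using assms by unfold_locales
  have d: "int (r - s + 1) = int r - int s + 1" "int (r - s) = int r - int s"
    "int (r - s - 1) = int r - int s - 1"
    using r by auto
  have "int (card F) \<le> int ((r - s + 1) + 2 * t * (r - s) + card (pendant_pairs r t) * (r - s - 1))"
    using card_H_le_star by linarith
  also have "\<dots> = (int r - int s + 1) + 2 * int t * (int r - int s)
      + int (card (pendant_pairs r t)) * (int r - int s - 1)"
    unfolding of_nat_add of_nat_mult d by simp
  \<comment> \<open>Equality, except for \<open>s = 2\<close> and \<open>t = 1\<close>, where
    \<open>sun_bound\<close> is larger by one.\<close>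
  also have "\<dots> \<le> sun_bound r s t"
    using s r by (auto simp: sun_bound_def card_pendant_pairs)
  finally show ?thesis .
qed

end

theorem theorem9:
  fixes n r s t :: nat
  assumes "s \<ge> 1"
    and "3 \<le> s + 2" and "s + 2 \<le> r"
    and "int r \<le> \<lfloor>(real n + real s - 1) / 2\<rfloor>"
  shows "EKR (sun n t) (paths r (sun n t)) s
    \<and> (real r < (real n + real s - 1) / 2 \<and> \<not> (s = 2 \<and> t = 1)
        \<longrightarrow> strictly_EKR (sun n t) (paths r (sun n t)) s)
    \<and> (\<forall>F \<subseteq> paths r (sun n t). s_intersecting s F \<longrightarrow> int (card F) \<le> sun_bound r s t)"
proof -
  have "real r \<le> (real n + real s - 1) / 2" using assms(4) by (simp add: le_floor_iff)
  then have "real (2 * r + 1) \<le> real (n + s)" by simp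
  then have "2 * r + 1 \<le> n + s" by (simp only: of_nat_le_iff)
  then interpret sun_setting n r s t using assms by unfold_locales
  have strict: "2 * r + 2 \<le> n + s" if "real r < (real n + real s - 1) / 2"
  proof -
    have "real (2 * r + 1) < real (n + s)" using that by simp
    then show ?thesis by (simp only: of_nat_less_iff)
  qed
  then show ?thesis using EKR_sun strictly_EKR_sun card_le_sun_bound by simp
qed

end
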